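(* Let $D$ be a weighted oriented star graph with underlying graph $S_n$ for some $n\ge2$. Then $I(D)^{(s)}=I(D)^s$ for all $s\ge2$.
   Context: Let $k$ be a field. A weighted oriented graph $D=(V(D),E(D),w)$ has a finite vertex set $V(D)$, a set $E(D)$ of ordered pairs of distinct vertices ($(x,y)\in E(D)$ is a directed edge from $x$ to $y$), each edge $\{x,y\}$ of the underlying simple graph $G$ carrying exactly one orientation, and a weight function $w:V(D)\to\mathbb N=\{1,2,\dots\}$. A vertex is a source if it has only outgoing edges; convention: sources have weight $1$. The edge ideal of $D$ is $I(D)=(x\,y^{w(y)} : (x,y)\in E(D))$ in the polynomial ring $R$ over $k$ whose variables are the vertices of $D$. For $s\ge1$ the $s$-th symbolic power of an ideal $I$ is $I^{(s)}=\bigcap_{P\in\operatorname{Ass}(I)}(I^sR_P\cap R)$, where $\operatorname{Ass}(I)$ is the set of associated primes of $R/I$. The star graph $S_n$ of order $n$ is the tree on $n+1$ vertices with one vertex of degree $n$ and the other $n$ vertices of degree $1$. *)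

theory Defs
  imports "HOL-Algebra.QuotRing" "HOL-Algebra.Ideal_Product" "HOL-Library.Poly_Mapping"
begin

section \<open>Commutative algebra\<close>

subsection \<open>Associated primes\<close>

definition associated_primes :: "('a, 'b) ring_scheme \<Rightarrow> 'a set \<Rightarrow> 'a set set" where
  "associated_primes R I =
     {P. primeideal P R \<and>
         (\<exists>x \<in> carrier (R Quot I).
            P = {r \<in> carrier R. (I +>\<^bsub>R\<^esub> r) \<otimes>\<^bsub>R Quot I\<^esub> x = \<zero>\<^bsub>R Quot I\<^esub>})}"

subsection \<open>Localization at a prime ideal\<close>

definition loc_rel :: "('a, 'b) ring_scheme \<Rightarrow> 'a set \<Rightarrow> (('a \<times> 'a) \<times> ('a \<times> 'a)) set" where
  "loc_rel R P =
     {((a, s), (b, t)) | a s b t.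
        a \<in> carrier R \<and> s \<in> carrier R - P \<and> b \<in> carrier R \<and> t \<in> carrier R - P \<and>
        (\<exists>u \<in> carrier R - P. u \<otimes>\<^bsub>R\<^esub> (a \<otimes>\<^bsub>R\<^esub> t \<ominus>\<^bsub>R\<^esub> b \<otimes>\<^bsub>R\<^esub> s) = \<zero>\<^bsub>R\<^esub>)}"

definition loc_frac :: "('a, 'b) ring_scheme \<Rightarrow> 'a set \<Rightarrow> 'a \<Rightarrow> 'a \<Rightarrow> ('a \<times> 'a) set" where
  "loc_frac R P a s = loc_rel R P `` {(a, s)}"

definition localization :: "('a, 'b) ring_scheme \<Rightarrow> 'a set \<Rightarrow> ('a \<times> 'a) set ring" where
  "localization R P =
     \<lparr> carrier = (carrier R \<times> (carrier R - P)) // loc_rel R P,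
       mult = (\<lambda>X Y. \<Union>(a, s) \<in> X. \<Union>(b, t) \<in> Y. loc_frac R P (a \<otimes>\<^bsub>R\<^esub> b) (s \<otimes>\<^bsub>R\<^esub> t)),
       one = loc_frac R P \<one>\<^bsub>R\<^esub> \<one>\<^bsub>R\<^esub>,
       zero = loc_frac R P \<zero>\<^bsub>R\<^esub> \<one>\<^bsub>R\<^esub>,
       add = (\<lambda>X Y. \<Union>(a, s) \<in> X. \<Union>(b, t) \<in> Y.
                loc_frac R P (a \<otimes>\<^bsub>R\<^esub> t \<oplus>\<^bsub>R\<^esub> b \<otimes>\<^bsub>R\<^esub> s) (s \<otimes>\<^bsub>R\<^esub> t)) \<rparr>"

definition loc_map :: "('a, 'b) ring_scheme \<Rightarrow> 'a set \<Rightarrow> 'a \<Rightarrow> ('a \<times> 'a) set" where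
  "loc_map R P a = loc_frac R P a \<one>\<^bsub>R\<^esub>"

text \<open>The ideal \<open>J R\<^sub>P\<close> and the contraction of an ideal of \<open>R\<^sub>P\<close> along \<open>R \<rightarrow> R\<^sub>P\<close>.\<close>

definition loc_extend :: "('a, 'b) ring_scheme \<Rightarrow> 'a set \<Rightarrow> 'a set \<Rightarrow> ('a \<times> 'a) set set" where
  "loc_extend R P J = genideal (localization R P) (loc_map R P ` J)"

definition loc_contract :: "('a, 'b) ring_scheme \<Rightarrow> 'a set \<Rightarrow> ('a \<times> 'a) set set \<Rightarrow> 'a set" where
  "loc_contract R P K = {a \<in> carrier R. loc_map R P a \<in> K}"

subsection \<open>Symbolic powers\<close>

text \<open>Ordinary powers of ideals are powers in the semiring of ideals \<^const>\<open>ideals_set\<close>.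
  Intersecting with \<open>carrier R\<close> only matters if there are no associated primes.\<close>

definition symbolic_power :: "('a, 'b) ring_scheme \<Rightarrow> 'a set \<Rightarrow> nat \<Rightarrow> 'a set" where
  "symbolic_power R I s =
     carrier R \<inter>
     (\<Inter>P \<in> associated_primes R I. loc_contract R P (loc_extend R P (I [^]\<^bsub>ideals_set R\<^esub> s)))"

text \<open>The following shows that the operations on the localization are well defined, so that
  \<^const>\<open>loc_extend\<close> is indeed an ideal of a ring.\<close>

context primeideal
begin

lemma UN2_pair_const:
  assumes "X \<noteq> {}" "Y \<noteq> {}"
    and "\<And>a s b t. (a, s) \<in> X \<Longrightarrow> (b, t) \<in> Y \<Longrightarrow> f a s b t = C"
  shows "(\<Union>(a, s) \<in> X. \<Union>(b, t) \<in> Y. f a s b t) = C"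
proof -
  have "(\<Union>(a, s) \<in> X. \<Union>(b, t) \<in> Y. f a s b t) = (\<Union>x \<in> X. \<Union>y \<in> Y. C)"
    by (intro SUP_cong refl) (auto simp: assms(3) split: prod.splits)
  then show ?thesis using assms(1,2) by simp
qed

lemma compl_mult_closed:
  "\<lbrakk>s \<in> carrier R - I; t \<in> carrier R - I\<rbrakk> \<Longrightarrow> s \<otimes> t \<in> carrier R - I"
  using I_prime by auto

lemma one_in_compl: "\<one> \<in> carrier R - I"
  using I_notcarr one_imp_carrier by auto

lemma loc_rel_iff:
  "((a, s), (b, t)) \<in> loc_rel R I \<longleftrightarrow>
     a \<in> carrier R \<and> s \<in> carrier R - I \<and> b \<in> carrier R \<and> t \<in> carrier R - I \<and>
     (\<exists>u \<in> carrier R - I. u \<otimes> (a \<otimes> t) = u \<otimes> (b \<otimes> s))"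
proof -
  have "u \<otimes> (a \<otimes> t \<ominus> b \<otimes> s) = \<zero> \<longleftrightarrow> u \<otimes> (a \<otimes> t) = u \<otimes> (b \<otimes> s)"
    if "u \<in> carrier R" "a \<in> carrier R" "b \<in> carrier R" "s \<in> carrier R" "t \<in> carrier R" for u
  proof -
    have "u \<otimes> (a \<otimes> t \<ominus> b \<otimes> s) = u \<otimes> (a \<otimes> t) \<ominus> u \<otimes> (b \<otimes> s)"
      using that by algebra
    moreover have "x \<ominus> y = \<zero> \<longleftrightarrow> x = y" if "x \<in> carrier R" "y \<in> carrier R" for x y
      using that sum_zero_eq_neg[of x "\<ominus> y"] by (auto simp: minus_eq r_neg)
    ultimately show ?thesis
      using that by simp
  qed
  then show ?thesis
    unfolding loc_rel_def by (auto; meson DiffI)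
qed

lemma loc_rel_equiv: "equiv (carrier R \<times> (carrier R - I)) (loc_rel R I)"
proof (rule equivI)
  show "loc_rel R I \<subseteq> (carrier R \<times> (carrier R - I)) \<times> (carrier R \<times> (carrier R - I))"
    by (auto simp: loc_rel_def)
  show "refl_on (carrier R \<times> (carrier R - I)) (loc_rel R I)"
    using one_in_compl by (auto simp: refl_on_def loc_rel_iff)
  show "sym (loc_rel R I)"
  proof (rule symI, clarify)
    fix a s b t assume "((a, s), (b, t)) \<in> loc_rel R I"
    then show "((b, t), (a, s)) \<in> loc_rel R I"
      unfolding loc_rel_iff by (elim conjE bexE) (intro conjI bexI; (assumption | rule sym, assumption))
  qed
  show "trans (loc_rel R I)"
  proof (rule transI, clarify)
    fix a s b t c r
    assume *: "((a, s), (b, t)) \<in> loc_rel R I" "((b, t), (c, r)) \<in> loc_rel R I"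
    then obtain u v where u: "u \<in> carrier R - I" "u \<otimes> (a \<otimes> t) = u \<otimes> (b \<otimes> s)"
      and v: "v \<in> carrier R - I" "v \<otimes> (b \<otimes> r) = v \<otimes> (c \<otimes> t)"
      unfolding loc_rel_iff by blast
    from * have car: "a \<in> carrier R" "s \<in> carrier R" "b \<in> carrier R" "t \<in> carrier R"
      "c \<in> carrier R" "r \<in> carrier R" "u \<in> carrier R" "v \<in> carrier R" "t \<in> carrier R - I"
      using u v by (auto simp: loc_rel_iff)
    have "(u \<otimes> v \<otimes> t) \<otimes> (a \<otimes> r) = (u \<otimes> (a \<otimes> t)) \<otimes> (v \<otimes> r)"
      using car by (simp add: m_ac)
    also have "\<dots> = (u \<otimes> s) \<otimes> (v \<otimes> (b \<otimes> r))"
      unfolding u(2) using car by (simp add: m_ac)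
    also have "\<dots> = (u \<otimes> v \<otimes> t) \<otimes> (c \<otimes> s)"
      unfolding v(2) using car by (simp add: m_ac)
    finally show "((a, s), (c, r)) \<in> loc_rel R I"
      using * compl_mult_closed[OF compl_mult_closed[OF u(1) v(1)] car(9)]
      by (auto simp: loc_rel_iff)
  qed
qed

lemma frac_eq_iff:
  assumes "a \<in> carrier R" "s \<in> carrier R - I" "b \<in> carrier R" "t \<in> carrier R - I"
  shows "loc_frac R I a s = loc_frac R I b t \<longleftrightarrow> (\<exists>u \<in> carrier R - I. u \<otimes> (a \<otimes> t) = u \<otimes> (b \<otimes> s))"
  unfolding loc_frac_def using assms
  by (subst eq_equiv_class_iff[OF loc_rel_equiv]) (auto simp: loc_rel_iff)

lemma frac_cancel:
  assumes "a \<in> carrier R" "s \<in> carrier R - I" "u \<in> carrier R - I"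
  shows "loc_frac R I (u \<otimes> a) (u \<otimes> s) = loc_frac R I a s"
  using assms compl_mult_closed[OF assms(3,2)] one_in_compl
  by (subst frac_eq_iff) (auto intro!: bexI[of _ \<one>] simp: m_ac)

lemma mem_frac_iff:
  "(b, t) \<in> loc_frac R I a s \<longleftrightarrow> ((a, s), (b, t)) \<in> loc_rel R I"
  by (simp add: loc_frac_def)

lemma frac_self: "\<lbrakk>a \<in> carrier R; s \<in> carrier R - I\<rbrakk> \<Longrightarrow> (a, s) \<in> loc_frac R I a s"
  using one_in_compl by (auto simp: mem_frac_iff loc_rel_iff)

lemma mem_fracD:
  assumes "(b, t) \<in> loc_frac R I a s"
  shows "b \<in> carrier R" "t \<in> carrier R - I" "loc_frac R I b t = loc_frac R I a s"
  using assms equiv_class_eq[OF loc_rel_equiv, of "(a, s)" "(b, t)"]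
  by (auto simp: mem_frac_iff loc_frac_def loc_rel_iff)

lemma loc_carrierE:
  assumes "X \<in> carrier (localization R I)"
  obtains a s where "a \<in> carrier R" "s \<in> carrier R - I" "X = loc_frac R I a s"
  using assms by (auto simp: localization_def quotient_def loc_frac_def)

lemma frac_in_carrier:
  "\<lbrakk>a \<in> carrier R; s \<in> carrier R - I\<rbrakk> \<Longrightarrow> loc_frac R I a s \<in> carrier (localization R I)"
  by (auto simp: localization_def quotient_def loc_frac_def)

lemma loc_mult_frac:
  assumes as: "a \<in> carrier R" "s \<in> carrier R - I" and bt: "b \<in> carrier R" "t \<in> carrier R - I"
  shows "loc_frac R I a s \<otimes>\<^bsub>localization R I\<^esub> loc_frac R I b t = loc_frac R I (a \<otimes> b) (s \<otimes> t)"
proof -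
  have "loc_frac R I (a' \<otimes> b') (s' \<otimes> t') = loc_frac R I (a \<otimes> b) (s \<otimes> t)"
    if *: "(a', s') \<in> loc_frac R I a s" "(b', t') \<in> loc_frac R I b t" for a' s' b' t'
  proof -
    from mem_fracD[OF *(1)] as obtain u where
      u: "u \<in> carrier R - I" "u \<otimes> (a' \<otimes> s) = u \<otimes> (a \<otimes> s')"
      and c1: "a' \<in> carrier R" "s' \<in> carrier R - I" by (auto simp: frac_eq_iff)
    from mem_fracD[OF *(2)] bt obtain v where
      v: "v \<in> carrier R - I" "v \<otimes> (b' \<otimes> t) = v \<otimes> (b \<otimes> t')"
      and c2: "b' \<in> carrier R" "t' \<in> carrier R - I" by (auto simp: frac_eq_iff)
    have car: "s \<in> carrier R" "t \<in> carrier R" "s' \<in> carrier R" "t' \<in> carrier R"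
      "u \<in> carrier R" "v \<in> carrier R" using as bt c1 c2 u v by auto
    have "(u \<otimes> v) \<otimes> ((a' \<otimes> b') \<otimes> (s \<otimes> t)) = (u \<otimes> (a' \<otimes> s)) \<otimes> (v \<otimes> (b' \<otimes> t))"
      using car as bt c1 c2 by (simp add: m_ac)
    also have "\<dots> = (u \<otimes> v) \<otimes> ((a \<otimes> b) \<otimes> (s' \<otimes> t'))"
      unfolding u(2) v(2) using car as bt c1 c2 by (simp add: m_ac)
    finally show ?thesis
      using compl_mult_closed[OF u(1) v(1)] compl_mult_closed[OF as(2) bt(2)]
        compl_mult_closed[OF c1(2) c2(2)] as(1) bt(1) c1(1) c2(1) car
      by (subst frac_eq_iff) blast+
  qed
  note wd = this
  have "loc_frac R I a s \<noteq> {}" "loc_frac R I b t \<noteq> {}"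
    using frac_self[OF as] frac_self[OF bt] by auto
  from UN2_pair_const[OF this wd] show ?thesis
    by (simp add: localization_def)
qed

lemma loc_add_frac:
  assumes as: "a \<in> carrier R" "s \<in> carrier R - I" and bt: "b \<in> carrier R" "t \<in> carrier R - I"
  shows "loc_frac R I a s \<oplus>\<^bsub>localization R I\<^esub> loc_frac R I b t = loc_frac R I (a \<otimes> t \<oplus> b \<otimes> s) (s \<otimes> t)"
proof -
  have "loc_frac R I (a' \<otimes> t' \<oplus> b' \<otimes> s') (s' \<otimes> t') = loc_frac R I (a \<otimes> t \<oplus> b \<otimes> s) (s \<otimes> t)"
    if *: "(a', s') \<in> loc_frac R I a s" "(b', t') \<in> loc_frac R I b t" for a' s' b' t'
  proof -
    from mem_fracD[OF *(1)] as obtain u where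
      u: "u \<in> carrier R - I" "u \<otimes> (a' \<otimes> s) = u \<otimes> (a \<otimes> s')"
      and c1: "a' \<in> carrier R" "s' \<in> carrier R - I" by (auto simp: frac_eq_iff)
    from mem_fracD[OF *(2)] bt obtain v where
      v: "v \<in> carrier R - I" "v \<otimes> (b' \<otimes> t) = v \<otimes> (b \<otimes> t')"
      and c2: "b' \<in> carrier R" "t' \<in> carrier R - I" by (auto simp: frac_eq_iff)
    have car: "s \<in> carrier R" "t \<in> carrier R" "s' \<in> carrier R" "t' \<in> carrier R"
      "u \<in> carrier R" "v \<in> carrier R" using as bt c1 c2 u v by auto
    have "(u \<otimes> v) \<otimes> ((a' \<otimes> t' \<oplus> b' \<otimes> s') \<otimes> (s \<otimes> t)) =
        (u \<otimes> (a' \<otimes> s)) \<otimes> (v \<otimes> (t \<otimes> t')) \<oplus> (v \<otimes> (b' \<otimes> t)) \<otimes> (u \<otimes> (s \<otimes> s'))"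
      using car as(1) bt(1) c1(1) c2(1) by algebra
    also have "\<dots> = (u \<otimes> v) \<otimes> ((a \<otimes> t \<oplus> b \<otimes> s) \<otimes> (s' \<otimes> t'))"
      unfolding u(2) v(2) using car as(1) bt(1) c1(1) c2(1) by algebra
    finally show ?thesis
      using compl_mult_closed[OF u(1) v(1)] compl_mult_closed[OF as(2) bt(2)]
        compl_mult_closed[OF c1(2) c2(2)] as(1) bt(1) c1(1) c2(1) car
      by (subst frac_eq_iff) blast+
  qed
  note wd = this
  have "loc_frac R I a s \<noteq> {}" "loc_frac R I b t \<noteq> {}"
    using frac_self[OF as] frac_self[OF bt] by auto
  from UN2_pair_const[OF this wd] show ?thesis
    by (simp add: localization_def)
qed

lemma loc_one: "\<one>\<^bsub>localization R I\<^esub> = loc_frac R I \<one> \<one>"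
  and loc_zero: "\<zero>\<^bsub>localization R I\<^esub> = loc_frac R I \<zero> \<one>"
  by (simp_all add: localization_def)

lemma localization_cring: "cring (localization R I)"
proof (rule cringI)
  let ?L = "localization R I"
  note [simp] = one_in_compl compl_mult_closed
  note one_c = one_in_compl
  show "abelian_group ?L"
  proof (rule abelian_groupI)
    fix X Y assume "X \<in> carrier ?L" "Y \<in> carrier ?L"
    then obtain a s b t where c: "a \<in> carrier R" "s \<in> carrier R - I" "b \<in> carrier R" "t \<in> carrier R - I"
      and X: "X = loc_frac R I a s" "Y = loc_frac R I b t" by (metis loc_carrierE)
    show "X \<oplus>\<^bsub>?L\<^esub> Y \<in> carrier ?L"
      using c compl_mult_closed[OF c(2,4)]
      by (auto simp: X loc_add_frac intro!: frac_in_carrier)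
    show "X \<oplus>\<^bsub>?L\<^esub> Y = Y \<oplus>\<^bsub>?L\<^esub> X"
      unfolding X loc_add_frac[OF c] loc_add_frac[OF c(3,4,1,2)]
      using c by (simp add: m_comm a_comm)
  next
    show "\<zero>\<^bsub>?L\<^esub> \<in> carrier ?L" using one_c by (simp add: loc_zero frac_in_carrier)
  next
    fix X Y Z assume "X \<in> carrier ?L" "Y \<in> carrier ?L" "Z \<in> carrier ?L"
    then obtain a s b t c r where c: "a \<in> carrier R" "s \<in> carrier R - I" "b \<in> carrier R"
      "t \<in> carrier R - I" "c \<in> carrier R" "r \<in> carrier R - I"
      and X: "X = loc_frac R I a s" "Y = loc_frac R I b t" "Z = loc_frac R I c r" by (metis loc_carrierE)
    have st: "s \<otimes> t \<in> carrier R - I" "t \<otimes> r \<in> carrier R - I"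
      by (intro compl_mult_closed c)+
    have "(a \<otimes> t \<oplus> b \<otimes> s) \<otimes> r \<oplus> c \<otimes> (s \<otimes> t) = a \<otimes> (t \<otimes> r) \<oplus> (b \<otimes> r \<oplus> c \<otimes> t) \<otimes> s"
      "(s \<otimes> t) \<otimes> r = s \<otimes> (t \<otimes> r)"
      using c(1,3,5) DiffD1[OF c(2)] DiffD1[OF c(4)] DiffD1[OF c(6)] by algebra+
    then show "X \<oplus>\<^bsub>?L\<^esub> Y \<oplus>\<^bsub>?L\<^esub> Z = X \<oplus>\<^bsub>?L\<^esub> (Y \<oplus>\<^bsub>?L\<^esub> Z)"
      using c st by (simp add: X loc_add_frac)
  next
    fix X assume "X \<in> carrier ?L"
    then obtain a s where c: "a \<in> carrier R" "s \<in> carrier R - I" and X: "X = loc_frac R I a s"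
      by (metis loc_carrierE)
    show "\<zero>\<^bsub>?L\<^esub> \<oplus>\<^bsub>?L\<^esub> X = X"
      using c one_c by (simp add: X loc_zero loc_add_frac)
    have "loc_frac R I (\<ominus> a) s \<oplus>\<^bsub>?L\<^esub> X = loc_frac R I (\<ominus> a \<otimes> s \<oplus> a \<otimes> s) (s \<otimes> s)"
      using c by (simp add: X loc_add_frac)
    also have "\<dots> = loc_frac R I \<zero> \<one>"
      using c one_c compl_mult_closed[OF c(2,2)]
      by (subst frac_eq_iff) (auto simp: l_minus l_neg)
    finally show "\<exists>Y\<in>carrier ?L. Y \<oplus>\<^bsub>?L\<^esub> X = \<zero>\<^bsub>?L\<^esub>"
      using c by (intro bexI[of _ "loc_frac R I (\<ominus> a) s"]) (auto simp: loc_zero intro: frac_in_carrier)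
  qed
  show "Group.comm_monoid ?L"
  proof (rule comm_monoidI)
    fix X Y assume "X \<in> carrier ?L" "Y \<in> carrier ?L"
    then obtain a s b t where c: "a \<in> carrier R" "s \<in> carrier R - I" "b \<in> carrier R" "t \<in> carrier R - I"
      and X: "X = loc_frac R I a s" "Y = loc_frac R I b t" by (metis loc_carrierE)
    show "X \<otimes>\<^bsub>?L\<^esub> Y \<in> carrier ?L"
      using c compl_mult_closed[OF c(2,4)]
      by (auto simp: X loc_mult_frac intro!: frac_in_carrier)
    show "X \<otimes>\<^bsub>?L\<^esub> Y = Y \<otimes>\<^bsub>?L\<^esub> X"
      using c by (simp add: X loc_mult_frac m_comm)
  next
    show "\<one>\<^bsub>?L\<^esub> \<in> carrier ?L" using one_c by (simp add: loc_one frac_in_carrier)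
  next
    fix X Y Z assume "X \<in> carrier ?L" "Y \<in> carrier ?L" "Z \<in> carrier ?L"
    then obtain a s b t c r where c: "a \<in> carrier R" "s \<in> carrier R - I" "b \<in> carrier R"
      "t \<in> carrier R - I" "c \<in> carrier R" "r \<in> carrier R - I"
      and X: "X = loc_frac R I a s" "Y = loc_frac R I b t" "Z = loc_frac R I c r" by (metis loc_carrierE)
    have st: "s \<otimes> t \<in> carrier R - I" "t \<otimes> r \<in> carrier R - I"
      by (intro compl_mult_closed c)+
    show "X \<otimes>\<^bsub>?L\<^esub> Y \<otimes>\<^bsub>?L\<^esub> Z = X \<otimes>\<^bsub>?L\<^esub> (Y \<otimes>\<^bsub>?L\<^esub> Z)"
      using c st by (simp add: X loc_mult_frac m_assoc)
  next
    fix X assume "X \<in> carrier ?L"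
    then obtain a s where c: "a \<in> carrier R" "s \<in> carrier R - I" and X: "X = loc_frac R I a s"
      by (metis loc_carrierE)
    show "\<one>\<^bsub>?L\<^esub> \<otimes>\<^bsub>?L\<^esub> X = X"
      using c one_c by (simp add: X loc_one loc_mult_frac)
  qed
  fix X Y Z assume "X \<in> carrier ?L" "Y \<in> carrier ?L" "Z \<in> carrier ?L"
  then obtain a s b t c r where c: "a \<in> carrier R" "s \<in> carrier R - I" "b \<in> carrier R"
    "t \<in> carrier R - I" "c \<in> carrier R" "r \<in> carrier R - I"
    and X: "X = loc_frac R I a s" "Y = loc_frac R I b t" "Z = loc_frac R I c r" by (metis loc_carrierE)
  have st: "s \<otimes> t \<in> carrier R - I" "s \<otimes> r \<in> carrier R - I" "t \<otimes> r \<in> carrier R - I"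
    "(s \<otimes> t) \<otimes> r \<in> carrier R - I"
    by (intro compl_mult_closed c)+
  have e: "(a \<otimes> c) \<otimes> (t \<otimes> r) \<oplus> (b \<otimes> c) \<otimes> (s \<otimes> r) = r \<otimes> ((a \<otimes> t \<oplus> b \<otimes> s) \<otimes> c)"
    "(s \<otimes> r) \<otimes> (t \<otimes> r) = r \<otimes> ((s \<otimes> t) \<otimes> r)"
    using c(1,3,5) DiffD1[OF c(2)] DiffD1[OF c(4)] DiffD1[OF c(6)] by algebra+
  have "(X \<otimes>\<^bsub>?L\<^esub> Z) \<oplus>\<^bsub>?L\<^esub> (Y \<otimes>\<^bsub>?L\<^esub> Z)
      = loc_frac R I (r \<otimes> ((a \<otimes> t \<oplus> b \<otimes> s) \<otimes> c)) (r \<otimes> ((s \<otimes> t) \<otimes> r))"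
    using c st by (simp add: X loc_mult_frac loc_add_frac e)
  also have "\<dots> = loc_frac R I ((a \<otimes> t \<oplus> b \<otimes> s) \<otimes> c) ((s \<otimes> t) \<otimes> r)"
    using c st by (intro frac_cancel) auto
  also have "\<dots> = (X \<oplus>\<^bsub>?L\<^esub> Y) \<otimes>\<^bsub>?L\<^esub> Z"
    using c st by (simp add: X loc_mult_frac loc_add_frac)
  finally show "(X \<oplus>\<^bsub>?L\<^esub> Y) \<otimes>\<^bsub>?L\<^esub> Z = (X \<otimes>\<^bsub>?L\<^esub> Z) \<oplus>\<^bsub>?L\<^esub> (Y \<otimes>\<^bsub>?L\<^esub> Z)" ..
qed

end

subsection \<open>Polynomial rings\<close>

text \<open>A monomial is its finitely supported exponent vector, a polynomial the finitely supported
  family of its coefficients; the type class product on the latter is the Cauchy product.\<close>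

type_synonym ('v, 'k) mpoly = "('v \<Rightarrow>\<^sub>0 nat) \<Rightarrow>\<^sub>0 'k"

definition mpoly_ring :: "'v set \<Rightarrow> ('v, 'k::field) mpoly ring" where
  "mpoly_ring V =
     \<lparr> carrier = {p. \<forall>m \<in> Poly_Mapping.keys p. Poly_Mapping.keys m \<subseteq> V},
       mult = (*), one = 1, zero = 0, add = (+) \<rparr>"

definition mvar :: "'v \<Rightarrow> ('v, 'k::field) mpoly" where
  "mvar x = Poly_Mapping.single (Poly_Mapping.single x 1) 1"

lemma mpoly_ring_cring: "cring (mpoly_ring V :: ('v, 'k::field) mpoly ring)"
proof -
  let ?C = "carrier (mpoly_ring V :: ('v, 'k) mpoly ring)"
  have mult: "p * q \<in> ?C" if "p \<in> ?C" "q \<in> ?C" for p q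
  proof -
    have "Poly_Mapping.keys m \<subseteq> V" if m: "m \<in> Poly_Mapping.keys (p * q)" for m
    proof -
      obtain a b where "m = a + b" "a \<in> Poly_Mapping.keys p" "b \<in> Poly_Mapping.keys q"
        using m keys_mult[of p q] by auto
      then show ?thesis
        using \<open>p \<in> ?C\<close> \<open>q \<in> ?C\<close> Poly_Mapping.keys_add[of a b]
        unfolding mpoly_ring_def by simp blast
    qed
    then show ?thesis by (auto simp: mpoly_ring_def)
  qed
  have add: "p + q \<in> ?C" if "p \<in> ?C" "q \<in> ?C" for p q
    using that Poly_Mapping.keys_add[of p q] unfolding mpoly_ring_def by simp blast
  have neg: "- p \<in> ?C" if "p \<in> ?C" for p
    using that by (auto simp: mpoly_ring_def)
  have zo: "0 \<in> ?C" "1 \<in> ?C"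
    by (auto simp: mpoly_ring_def)
  have ops: "(\<otimes>\<^bsub>mpoly_ring V\<^esub>) = ((*) :: ('v, 'k) mpoly \<Rightarrow> _)"
    "(\<oplus>\<^bsub>mpoly_ring V\<^esub>) = ((+) :: ('v, 'k) mpoly \<Rightarrow> _)"
    "\<one>\<^bsub>mpoly_ring V\<^esub> = (1 :: ('v, 'k) mpoly)" "\<zero>\<^bsub>mpoly_ring V\<^esub> = (0 :: ('v, 'k) mpoly)"
    by (simp_all add: mpoly_ring_def)
  show ?thesis
  proof (rule cringI)
    show "abelian_group (mpoly_ring V :: ('v, 'k) mpoly ring)"
    proof (rule abelian_groupI, unfold ops)
      fix p assume "p \<in> ?C"
      then show "\<exists>q \<in> ?C. q + p = 0"
        by (intro bexI[of _ "- p"] neg) simp_all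
    qed (simp_all only: add zo ac_simps add_0_left add_0_right)
    show "Group.comm_monoid (mpoly_ring V :: ('v, 'k) mpoly ring)"
      by (rule comm_monoidI, unfold ops)
        (simp_all only: mult zo ac_simps mult_1_left mult_1_right)
  qed (simp only: ops distrib_right)
qed

section \<open>Graphs\<close>

subsection \<open>Simple graphs\<close>

text \<open>A simple graph is given by its vertex set and its set of two-element edges.\<close>

definition graph_connected :: "'v set \<Rightarrow> 'v set set \<Rightarrow> bool" where
  "graph_connected V F \<longleftrightarrow> V \<noteq> {} \<and> (\<forall>x \<in> V. \<forall>y \<in> V. (x, y) \<in> {(u, v). {u, v} \<in> F}\<^sup>*)"

definition graph_cycle :: "'v set set \<Rightarrow> 'v list \<Rightarrow> bool" where
  "graph_cycle F xs \<longleftrightarrow> length xs \<ge> 3 \<and> distinct xs \<and>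
     (\<forall>i < length xs - 1. {xs ! i, xs ! (i + 1)} \<in> F) \<and> {last xs, hd xs} \<in> F"

definition graph_tree :: "'v set \<Rightarrow> 'v set set \<Rightarrow> bool" where
  "graph_tree V F \<longleftrightarrow> graph_connected V F \<and> (\<nexists>xs. graph_cycle F xs)"

definition graph_degree :: "'v set set \<Rightarrow> 'v \<Rightarrow> nat" where
  "graph_degree F v = card {e \<in> F. v \<in> e}"

definition star_graph :: "nat \<Rightarrow> 'v set \<Rightarrow> 'v set set \<Rightarrow> bool" where
  "star_graph n V F \<longleftrightarrow> graph_tree V F \<and> card V = n + 1 \<and>
     (\<exists>c \<in> V. graph_degree F c = n \<and> (\<forall>v \<in> V - {c}. graph_degree F v = 1))"

subsection \<open>Weighted oriented graphs\<close>

record 'v wo_graph =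
  verts :: "'v set"
  edges :: "('v \<times> 'v) set"
  weight :: "'v \<Rightarrow> nat"

definition is_source :: "'v wo_graph \<Rightarrow> 'v \<Rightarrow> bool" where
  "is_source D x \<longleftrightarrow> x \<in> verts D \<and> (\<nexists>u. (u, x) \<in> edges D)"

definition weighted_oriented_graph :: "'v wo_graph \<Rightarrow> bool" where
  "weighted_oriented_graph D \<longleftrightarrow>
     finite (verts D) \<and>
     edges D \<subseteq> verts D \<times> verts D \<and>
     (\<forall>x y. (x, y) \<in> edges D \<longrightarrow> x \<noteq> y \<and> (y, x) \<notin> edges D) \<and>
     (\<forall>x \<in> verts D. weight D x \<ge> 1) \<and>
     (\<forall>x. is_source D x \<longrightarrow> weight D x = 1)"

definition underlying_edges :: "'v wo_graph \<Rightarrow> 'v set set" where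
  "underlying_edges D = {{x, y} | x y. (x, y) \<in> edges D}"

definition edge_ideal :: "'v wo_graph \<Rightarrow> ('v, 'k::field) mpoly set" where
  "edge_ideal D =
     genideal (mpoly_ring (verts D)) {mvar x * mvar y ^ weight D y | x y. (x, y) \<in> edges D}"

end

theory Submission
  imports Defs
begin

text \<open>Let \<open>c\<close> be the center, \<open>w\<close> its weight, \<open>A\<close> the leaves with an edge into \<open>c\<close> and \<open>B\<close> those
  with an edge from \<open>c\<close>. For a monomial \<open>m\<close> let \<open>\<gamma>\<close> be its exponent at \<open>c\<close>, \<open>\<alpha>\<close> its degree in
  \<open>A\<close>, and \<open>\<beta>\<close> the sum over \<open>b \<in> B\<close> of the exponent at \<open>b\<close> divided by the weight of \<open>b\<close>, rounded
  down. Then \<open>m\<close> lies in the \<open>s\<close>-th power of the edge ideal iff \<open>s = i + j\<close> for some \<open>i \<le> \<alpha>\<close> and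
  \<open>j \<le> \<beta>\<close> with \<open>w i + j \<le> \<gamma>\<close>. Localizing at the associated prime generated by all leaves inverts
  \<open>c\<close> and leaves the condition \<open>s \<le> \<alpha> + \<beta>\<close>. Localizing at the prime generated by \<open>c\<close> and \<open>B\<close> (or by
  \<open>c\<close> alone, if \<open>w = 1\<close>) inverts \<open>A\<close> and leaves the condition without \<open>i \<le> \<alpha>\<close>. Both together imply
  the condition for the ordinary power: take \<open>j = min s \<beta>\<close>, the largest possible value.\<close>

section \<open>Extension and contraction of ideals along a localization\<close>

text \<open>Putting sums over a common denominator shows that the fractions with numerator in
  \<open>J\<close> form an ideal. As it contains the image of \<open>J\<close>, it contains the
  ideal generated by that image.\<close>

lemma (in primeideal) loc_extend_frac:
  assumes J: "ideal J R" and X: "X \<in> loc_extend R I J"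
  shows "\<exists>a \<in> J. \<exists>t \<in> carrier R - I. X = loc_frac R I a t"
proof -
  let ?L = "localization R I"
  let ?E = "{loc_frac R I a t | a t. a \<in> J \<and> t \<in> carrier R - I}"
  interpret L: cring ?L by (rule localization_cring)
  interpret J: ideal J R by fact
  have neg: "\<ominus>\<^bsub>?L\<^esub> loc_frac R I a t = loc_frac R I (\<ominus> a) t"
    if "a \<in> carrier R" "t \<in> carrier R - I" for a t
  proof (rule L.minus_equality)
    have "loc_frac R I (\<ominus> a) t \<oplus>\<^bsub>?L\<^esub> loc_frac R I a t
        = loc_frac R I (\<ominus> a \<otimes> t \<oplus> a \<otimes> t) (t \<otimes> t)"
      using that by (simp add: loc_add_frac)
    also have "\<dots> = loc_frac R I \<zero> \<one>"
      using that one_in_compl compl_mult_closed[OF that(2,2)]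
      by (subst frac_eq_iff) (auto simp: l_minus l_neg)
    finally show "loc_frac R I (\<ominus> a) t \<oplus>\<^bsub>?L\<^esub> loc_frac R I a t = \<zero>\<^bsub>?L\<^esub>"
      by (simp add: loc_zero)
  qed (use that in \<open>auto intro: frac_in_carrier\<close>)
  have l: "x \<otimes>\<^bsub>?L\<^esub> y \<in> ?E" if y: "y \<in> ?E" and x: "x \<in> carrier ?L" for x y
  proof -
    from y obtain a t where at: "a \<in> J" "t \<in> carrier R - I" "y = loc_frac R I a t"
      by blast
    from x obtain b r where br: "b \<in> carrier R" "r \<in> carrier R - I" "x = loc_frac R I b r"
      by (rule loc_carrierE)
    have "x \<otimes>\<^bsub>?L\<^esub> y = loc_frac R I (b \<otimes> a) (r \<otimes> t)"
      using at br J.Icarr by (simp add: loc_mult_frac)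
    moreover have "b \<otimes> a \<in> J" "r \<otimes> t \<in> carrier R - I"
      using at br J.I_l_closed compl_mult_closed by blast+
    ultimately show ?thesis by blast
  qed
  have sub: "?E \<subseteq> carrier ?L"
    using J.Icarr frac_in_carrier by blast
  have "ideal ?E ?L"
  proof (rule idealI[OF L.ring_axioms])
    show "subgroup ?E (add_monoid ?L)"
    proof (rule L.add.subgroupI)
      show "?E \<noteq> {}" using J.zero_closed one_in_compl by blast
      fix x assume "x \<in> ?E"
      then obtain a t where at: "a \<in> J" "t \<in> carrier R - I" "x = loc_frac R I a t"
        by blast
      then show "\<ominus>\<^bsub>?L\<^esub> x \<in> ?E"
        using neg[OF J.Icarr] J.a_inv_closed by auto
      fix y assume "y \<in> ?E"
      then obtain b r where br: "b \<in> J" "r \<in> carrier R - I" "y = loc_frac R I b r"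
        by blast
      have "x \<oplus>\<^bsub>?L\<^esub> y = loc_frac R I (a \<otimes> r \<oplus> b \<otimes> t) (t \<otimes> r)"
        using at br J.Icarr by (simp add: loc_add_frac)
      moreover have "a \<otimes> r \<oplus> b \<otimes> t \<in> J" "t \<otimes> r \<in> carrier R - I"
        using at br by (auto intro!: J.a_closed J.I_r_closed simp: I_prime dest: I_prime)
      ultimately show "x \<oplus>\<^bsub>?L\<^esub> y \<in> ?E" by blast
    qed (use sub in auto)
    show "x \<otimes>\<^bsub>?L\<^esub> y \<in> ?E" if "y \<in> ?E" "x \<in> carrier ?L" for x y
      by (rule l[OF that])
    show "y \<otimes>\<^bsub>?L\<^esub> x \<in> ?E" if "y \<in> ?E" "x \<in> carrier ?L" for x y
      using l[OF that] that sub L.m_comm by (metis (no_types, lifting) subsetD)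
  qed
  moreover have "loc_map R I ` J \<subseteq> ?E"
    using one_in_compl by (auto simp: loc_map_def)
  ultimately have "loc_extend R I J \<subseteq> ?E"
    unfolding loc_extend_def by (rule L.genideal_minimal)
  with X show ?thesis by blast
qed

text \<open>An equality a/1 = b/t clears to u t a = u b with u and t outside the prime; conversely,
  a/1 is the product of 1/u and (u a)/1. This turns membership after localization into a condition
  in the ring itself.\<close>

lemma (in primeideal) loc_contract_extend:
  assumes J: "ideal J R"
  shows "loc_contract R I (loc_extend R I J) = {a \<in> carrier R. \<exists>u \<in> carrier R - I. u \<otimes> a \<in> J}"
proof (intro equalityI subsetI)
  interpret J: ideal J R by fact
  interpret L: cring "localization R I" by (rule localization_cring)
  have maps: "loc_map R I ` J \<subseteq> carrier (localization R I)"
    using J.Icarr one_in_compl frac_in_carrier by (auto simp: loc_map_def)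
  {
    fix a assume "a \<in> loc_contract R I (loc_extend R I J)"
    then have a: "a \<in> carrier R" "loc_frac R I a \<one> \<in> loc_extend R I J"
      by (auto simp: loc_contract_def loc_map_def)
    from loc_extend_frac[OF J a(2)] obtain b t where
      b: "b \<in> J" "t \<in> carrier R - I" "loc_frac R I a \<one> = loc_frac R I b t" by blast
    then obtain u where u: "u \<in> carrier R - I" "u \<otimes> (a \<otimes> t) = u \<otimes> (b \<otimes> \<one>)"
      using frac_eq_iff[OF a(1) one_in_compl J.Icarr] by blast
    have "(u \<otimes> t) \<otimes> a = u \<otimes> b"
      using u a b J.Icarr by (simp add: m_ac)
    also have "\<dots> \<in> J" using u b J.I_l_closed by blast
    finally show "a \<in> {a \<in> carrier R. \<exists>u \<in> carrier R - I. u \<otimes> a \<in> J}"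
      using compl_mult_closed[OF u(1) b(2)] a by blast
  next
    fix a assume "a \<in> {a \<in> carrier R. \<exists>u \<in> carrier R - I. u \<otimes> a \<in> J}"
    then obtain u where u: "a \<in> carrier R" "u \<in> carrier R - I" "u \<otimes> a \<in> J" by blast
    interpret E: ideal "loc_extend R I J" "localization R I"
      unfolding loc_extend_def by (rule L.genideal_ideal[OF maps])
    have "loc_map R I (u \<otimes> a) \<in> loc_extend R I J"
      using L.genideal_self[OF maps] u(3) by (auto simp: loc_extend_def)
    then have "loc_frac R I \<one> u \<otimes>\<^bsub>localization R I\<^esub> loc_map R I (u \<otimes> a) \<in> loc_extend R I J"
      using u by (intro E.I_l_closed frac_in_carrier) auto
    also have "loc_frac R I \<one> u \<otimes>\<^bsub>localization R I\<^esub> loc_map R I (u \<otimes> a) = loc_frac R I (u \<otimes> a) (u \<otimes> \<one>)"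
      using u one_in_compl by (simp add: loc_map_def loc_mult_frac)
    also have "\<dots> = loc_map R I a"
      using u one_in_compl unfolding loc_map_def by (intro frac_cancel) auto
    finally show "a \<in> loc_contract R I (loc_extend R I J)"
      using u by (simp add: loc_contract_def)
  }
qed

section \<open>Symbolic powers and associated primes\<close>

text \<open>Associated primes are prime, so contraction after extension applies to each of them.
  Later arguments use symbolic powers only in this form, which mentions no fractions.\<close>

lemma symbolic_power_eq:
  assumes "ideal (I [^]\<^bsub>ideals_set R\<^esub> s) R"
  shows "symbolic_power R I s = {a \<in> carrier R. \<forall>P \<in> associated_primes R I.
           \<exists>u \<in> carrier R - P. u \<otimes>\<^bsub>R\<^esub> a \<in> I [^]\<^bsub>ideals_set R\<^esub> s}"
proof -
  have "loc_contract R P (loc_extend R P (I [^]\<^bsub>ideals_set R\<^esub> s))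
      = {a \<in> carrier R. \<exists>u \<in> carrier R - P. u \<otimes>\<^bsub>R\<^esub> a \<in> I [^]\<^bsub>ideals_set R\<^esub> s}"
    if "P \<in> associated_primes R I" for P
    using that primeideal.loc_contract_extend[OF _ assms]
    unfolding associated_primes_def by blast
  then show ?thesis
    unfolding symbolic_power_def by auto
qed

text \<open>The set is the annihilator of the coset of \<open>x\<close> in the quotient
  ring.\<close>

lemma colon_associated_prime:
  assumes "ideal I R" "x \<in> carrier R" "primeideal {r \<in> carrier R. r \<otimes>\<^bsub>R\<^esub> x \<in> I} R"
  shows "{r \<in> carrier R. r \<otimes>\<^bsub>R\<^esub> x \<in> I} \<in> associated_primes R I"
proof -
  interpret ideal I R by fact
  have "(I +>\<^bsub>R\<^esub> r) \<otimes>\<^bsub>R Quot I\<^esub> (I +>\<^bsub>R\<^esub> x) = \<zero>\<^bsub>R Quot I\<^esub> \<longleftrightarrow> r \<otimes>\<^bsub>R\<^esub> x \<in> I"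
    if "r \<in> carrier R" for r
    using that assms(2) a_rcos_const a_coset_join1[OF _ _ a_subgroup]
    by (auto simp: FactRing_def rcoset_mult_add)
  moreover have "I +>\<^bsub>R\<^esub> x \<in> carrier (R Quot I)"
    using assms(2) by (auto simp: FactRing_def A_RCOSETS_def')
  ultimately show ?thesis
    unfolding associated_primes_def using assms(3) by blast
qed

section \<open>Terms and products of polynomials\<close>

lemma carrier_mpoly_ring: "p \<in> carrier (mpoly_ring V) \<longleftrightarrow> (\<forall>m \<in> Poly_Mapping.keys p. Poly_Mapping.keys m \<subseteq> V)"
  and mult_mpoly_ring: "p \<otimes>\<^bsub>mpoly_ring V\<^esub> q = p * q"
  and add_mpoly_ring: "p \<oplus>\<^bsub>mpoly_ring V\<^esub> q = p + q"
  and zero_mpoly_ring: "\<zero>\<^bsub>mpoly_ring V\<^esub> = 0"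
  and one_mpoly_ring: "\<one>\<^bsub>mpoly_ring V\<^esub> = 1"
  by (simp_all add: mpoly_ring_def)

lemmas mpoly_ring_simps =
  carrier_mpoly_ring mult_mpoly_ring add_mpoly_ring zero_mpoly_ring one_mpoly_ring

lemma uminus_mpoly_ring:
  assumes "p \<in> carrier (mpoly_ring V)"
  shows "\<ominus>\<^bsub>mpoly_ring V\<^esub> p = - p"
proof -
  interpret cring "mpoly_ring V" by (rule mpoly_ring_cring)
  show ?thesis
    by (rule minus_equality) (use assms in \<open>auto simp: mpoly_ring_simps\<close>)
qed

lemma keys_add_nat: "Poly_Mapping.keys (a + b) = Poly_Mapping.keys a \<union> Poly_Mapping.keys b"
  for a b :: "'v \<Rightarrow>\<^sub>0 nat"
  by (auto simp: in_keys_iff lookup_add)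

lemma minus_add_monomial:
  assumes "\<And>x. Poly_Mapping.lookup g x \<le> Poly_Mapping.lookup m x"
  shows "(m - g) + g = (m :: 'v \<Rightarrow>\<^sub>0 nat)"
  by (rule poly_mapping_eqI) (simp add: lookup_add lookup_minus assms)

lemma sum_monomials: "(\<Sum>m \<in> Poly_Mapping.keys p. Poly_Mapping.single m (Poly_Mapping.lookup p m)) = p"
proof (rule poly_mapping_eqI)
  fix k
  show "Poly_Mapping.lookup (\<Sum>m \<in> Poly_Mapping.keys p. Poly_Mapping.single m (Poly_Mapping.lookup p m)) k
      = Poly_Mapping.lookup p k"
    by (simp add: lookup_sum lookup_single when_def in_keys_iff sum.If_cases if_distrib cong: if_cong)
qed

text \<open>The hypothesis leaves only \<open>a = a0\<close> in the convolution sum, and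
  cancellation then forces \<open>b = b0\<close>.\<close>

lemma lookup_mult_unique:
  fixes p q :: "'a::cancel_comm_monoid_add \<Rightarrow>\<^sub>0 'k::semiring_0"
  assumes "\<And>a b. \<lbrakk>a \<in> Poly_Mapping.keys p; b \<in> Poly_Mapping.keys q; a + b = a0 + b0\<rbrakk> \<Longrightarrow> a = a0"
  shows "Poly_Mapping.lookup (p * q) (a0 + b0) = Poly_Mapping.lookup p a0 * Poly_Mapping.lookup q b0"
proof -
  have "Poly_Mapping.lookup p a * (\<Sum>b. Poly_Mapping.lookup q b when a0 + b0 = a + b)
      = (Poly_Mapping.lookup p a0 * Poly_Mapping.lookup q b0 when a = a0)" for a
  proof (cases "a = a0")
    case True
    then show ?thesis by (simp add: eq_commute)
  next
    case False
    have "Poly_Mapping.lookup p a * (\<Sum>b. Poly_Mapping.lookup q b when a0 + b0 = a + b) = 0"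
    proof (cases "a \<in> Poly_Mapping.keys p")
      case True
      then have "(Poly_Mapping.lookup q b when a0 + b0 = a + b) = 0" for b
        using assms[OF True _ sym, of b] False by (auto simp: when_def in_keys_iff)
      then show ?thesis by simp
    qed (simp add: in_keys_iff)
    with False show ?thesis by simp
  qed
  then show ?thesis by (simp add: lookup_mult)
qed

text \<open>A substitute for a monomial order: a linear functional that separates finitely many
  exponent vectors.\<close>

lemma separating_weights:
  fixes F :: "('v \<Rightarrow> nat) set"
  assumes "finite V" "finite F"
  shows "\<exists>l :: 'v \<Rightarrow> nat. \<forall>f \<in> F. \<forall>g \<in> F.
    (\<Sum>x \<in> V. f x * l x) = (\<Sum>x \<in> V. g x * l x) \<longrightarrow> (\<forall>x \<in> V. f x = g x)"
  using assms(1)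
proof (induction V rule: finite_induct)
  case empty
  then show ?case by simp
next
  case (insert y V)
  then obtain l where l: "\<And>f g. \<lbrakk>f \<in> F; g \<in> F; (\<Sum>x \<in> V. f x * l x) = (\<Sum>x \<in> V. g x * l x)\<rbrakk>
      \<Longrightarrow> \<forall>x \<in> V. f x = g x"
    by blast
  \<comment> \<open>\<open>N\<close> exceeds every value of the old functional on \<open>F\<close>.
    With weight \<open>N\<close> at \<open>y\<close>, the new value is a multiple of
    \<open>N\<close> plus the old value, and \<open>div\<close> and \<open>mod\<close> recover both
    parts.\<close>
  define N where "N = Suc (\<Sum>f \<in> F. \<Sum>x \<in> V. f x * l x)"
  have N: "(\<Sum>x \<in> V. f x * l x) < N" if "f \<in> F" for f
    unfolding N_def less_Suc_eq_le by (rule member_le_sum) (use that assms(2) in auto)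
  let ?l = "l(y := N)"
  have eq: "(\<Sum>x \<in> insert y V. f x * ?l x) = f y * N + (\<Sum>x \<in> V. f x * l x)" for f
  proof -
    have "(\<Sum>x \<in> V. f x * ?l x) = (\<Sum>x \<in> V. f x * l x)"
      by (rule sum.cong) (use insert.hyps in auto)
    then show ?thesis using insert.hyps by simp
  qed
  have "\<forall>x \<in> insert y V. f x = g x"
    if fg: "f \<in> F" "g \<in> F" "(\<Sum>x \<in> insert y V. f x * ?l x) = (\<Sum>x \<in> insert y V. g x * ?l x)" for f g
  proof -
    have e: "f y * N + (\<Sum>x \<in> V. f x * l x) = g y * N + (\<Sum>x \<in> V. g x * l x)"
      using fg(3) unfolding eq .
    have "(f y * N + (\<Sum>x \<in> V. f x * l x)) div N = f y"
      "(f y * N + (\<Sum>x \<in> V. f x * l x)) mod N = (\<Sum>x \<in> V. f x * l x)"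
      "(g y * N + (\<Sum>x \<in> V. g x * l x)) div N = g y"
      "(g y * N + (\<Sum>x \<in> V. g x * l x)) mod N = (\<Sum>x \<in> V. g x * l x)"
      using N[OF fg(1)] N[OF fg(2)] by auto
    with e have "f y = g y" "(\<Sum>x \<in> V. f x * l x) = (\<Sum>x \<in> V. g x * l x)"
      by metis+
    with l[OF fg(1,2)] show ?thesis by blast
  qed
  then show ?case by blast
qed

section \<open>Monomial ideals and their powers\<close>

text \<open>\<open>M\<close> collects all admissible exponents, not just generators, so inclusions
  of ideals follow from inclusions of exponent sets. It may contain monomials in variables outside
  \<open>V\<close>; the carrier cuts them off, so that \<open>M\<close> can be described without
  \<open>V\<close>.\<close>

definition monomial_ideal :: "'v set \<Rightarrow> ('v \<Rightarrow>\<^sub>0 nat) set \<Rightarrow> ('v, 'k::field) mpoly set" where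
  "monomial_ideal V M = {p \<in> carrier (mpoly_ring V). Poly_Mapping.keys p \<subseteq> M}"

definition absorbing :: "('v \<Rightarrow>\<^sub>0 nat) set \<Rightarrow> bool" where
  "absorbing M \<longleftrightarrow> (\<forall>m \<in> M. \<forall>k. k + m \<in> M)"

lemma keys_mult_absorbing:
  assumes "absorbing M" "Poly_Mapping.keys q \<subseteq> M"
  shows "Poly_Mapping.keys (p * q) \<subseteq> M"
proof
  fix m assume "m \<in> Poly_Mapping.keys (p * q)"
  then obtain a b where "m = a + b" "b \<in> Poly_Mapping.keys q"
    using keys_mult[of p q] by auto
  then show "m \<in> M" using assms by (auto simp: absorbing_def)
qed

lemma ideal_monomial_ideal:
  fixes M :: "('v \<Rightarrow>\<^sub>0 nat) set"
  assumes M: "absorbing M"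
  shows "ideal (monomial_ideal V M :: ('v, 'k::field) mpoly set) (mpoly_ring V)"
proof -
  interpret R: cring "mpoly_ring V :: ('v, 'k) mpoly ring" by (rule mpoly_ring_cring)
  let ?R = "mpoly_ring V :: ('v, 'k) mpoly ring"
  show ?thesis
  proof (rule idealI[OF R.ring_axioms])
    show "subgroup (monomial_ideal V M) (add_monoid ?R)"
    proof (rule R.add.subgroupI)
      have "\<zero>\<^bsub>?R\<^esub> \<in> monomial_ideal V M"
        by (auto simp: monomial_ideal_def mpoly_ring_simps)
      then show "monomial_ideal V M \<noteq> ({} :: ('v, 'k) mpoly set)" by blast
      fix p :: "('v, 'k) mpoly" assume p: "p \<in> monomial_ideal V M"
      then show "\<ominus>\<^bsub>?R\<^esub> p \<in> monomial_ideal V M"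
        using R.a_inv_closed[of p] by (auto simp: monomial_ideal_def uminus_mpoly_ring)
      fix q :: "('v, 'k) mpoly" assume q: "q \<in> monomial_ideal V M"
      show "p \<oplus>\<^bsub>?R\<^esub> q \<in> monomial_ideal V M"
        using p q R.a_closed[of p q] Poly_Mapping.keys_add[of p q]
        by (auto simp: monomial_ideal_def add_mpoly_ring)
    qed (auto simp: monomial_ideal_def)
    fix p q :: "('v, 'k) mpoly" assume *: "p \<in> monomial_ideal V M" "q \<in> carrier ?R"
    show "q \<otimes>\<^bsub>?R\<^esub> p \<in> monomial_ideal V M"
      using * R.m_closed[of q p] keys_mult_absorbing[OF M, of p q]
      by (auto simp: monomial_ideal_def mult_mpoly_ring)
    then show "p \<otimes>\<^bsub>?R\<^esub> q \<in> monomial_ideal V M"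
      by (simp add: mult_mpoly_ring mult.commute)
  qed
qed

text \<open>A polynomial is the sum of its terms. The coefficient \<open>c\<close> is arbitrary in
  \<open>mono\<close> because \<open>J\<close> is only assumed to be closed under sums and to
  contain zero.\<close>

lemma monomial_ideal_subset:
  fixes J :: "('v, 'k::field) mpoly set"
  assumes add: "\<And>p q. \<lbrakk>p \<in> J; q \<in> J\<rbrakk> \<Longrightarrow> p + q \<in> J" and zero: "0 \<in> J"
    and mono: "\<And>m c. \<lbrakk>m \<in> M; Poly_Mapping.keys m \<subseteq> V\<rbrakk> \<Longrightarrow> Poly_Mapping.single m c \<in> J"
  shows "monomial_ideal V M \<subseteq> J"
proof
  fix p :: "('v, 'k) mpoly" assume p: "p \<in> monomial_ideal V M"
  have "(\<Sum>m \<in> K. Poly_Mapping.single m (Poly_Mapping.lookup p m)) \<in> J"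
    if "finite K" "K \<subseteq> Poly_Mapping.keys p" for K
    using that
  proof (induction K rule: finite_induct)
    case empty
    then show ?case using zero by simp
  next
    case (insert m K)
    then show ?case
      using p by (auto simp: monomial_ideal_def carrier_mpoly_ring intro!: add mono)
  qed
  from this[of "Poly_Mapping.keys p"] show "p \<in> J" by (simp add: sum_monomials)
qed

text \<open>The exponents \<open>k + g\<close> form an absorbing set, and conversely a term with
  exponent \<open>k + g\<close> is a multiple of the generator with exponent
  \<open>g\<close>.\<close>

lemma genideal_monomials:
  fixes G :: "('v \<Rightarrow>\<^sub>0 nat) set"
  assumes G: "\<And>g. g \<in> G \<Longrightarrow> Poly_Mapping.keys g \<subseteq> V"
  shows "genideal (mpoly_ring V) ((\<lambda>g. Poly_Mapping.single g (1::'k::field)) ` G)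
    = monomial_ideal V {k + g | k g. g \<in> G}"
proof (rule equalityI)
  let ?R = "mpoly_ring V :: ('v, 'k) mpoly ring"
  let ?S = "(\<lambda>g. Poly_Mapping.single g (1::'k)) ` G"
  interpret R: cring ?R by (rule mpoly_ring_cring)
  have S: "?S \<subseteq> carrier ?R"
    using G by (auto simp: carrier_mpoly_ring)
  interpret J: ideal "genideal ?R ?S" ?R by (rule R.genideal_ideal[OF S])
  have "absorbing {k + g | k g. g \<in> G}"
    unfolding absorbing_def by (auto simp flip: add.assoc) blast
  moreover have "g \<in> {k + g | k g. g \<in> G}" if "g \<in> G" for g
    using that by (metis (mono_tags, lifting) add_0_left mem_Collect_eq)
  ultimately show "genideal ?R ?S \<subseteq> monomial_ideal V {k + g | k g. g \<in> G}"
    using S by (intro R.genideal_minimal ideal_monomial_ideal) (auto simp: monomial_ideal_def)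
  show "monomial_ideal V {k + g | k g. g \<in> G} \<subseteq> genideal ?R ?S"
  proof (rule monomial_ideal_subset)
    show "p + q \<in> genideal ?R ?S" if "p \<in> genideal ?R ?S" "q \<in> genideal ?R ?S" for p q
      using J.a_closed[OF that] by (simp add: add_mpoly_ring)
    show "0 \<in> genideal ?R ?S"
      using J.zero_closed by (simp add: zero_mpoly_ring)
    fix m and c :: 'k assume m: "m \<in> {k + g | k g. g \<in> G}" "Poly_Mapping.keys m \<subseteq> V"
    then obtain k g where kg: "m = k + g" "g \<in> G" by blast
    have "Poly_Mapping.single k c \<otimes>\<^bsub>?R\<^esub> Poly_Mapping.single g 1 \<in> genideal ?R ?S"
      using m kg R.genideal_self[OF S]
      by (intro J.I_l_closed) (auto simp: carrier_mpoly_ring keys_add_nat)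
    then show "Poly_Mapping.single m c \<in> genideal ?R ?S"
      by (simp add: mult_mpoly_ring mult_single kg)
  qed
qed

text \<open>Exponents of a product are sums of exponents of the factors; conversely, a term with
  exponent \<open>a + b\<close> factors, with its coefficient placed on the first factor.\<close>

lemma ideal_prod_monomial_ideal:
  fixes M N :: "('v \<Rightarrow>\<^sub>0 nat) set"
  assumes M: "absorbing M" and N: "absorbing N"
  shows "ideal_prod (mpoly_ring V) (monomial_ideal V M :: ('v, 'k::field) mpoly set) (monomial_ideal V N)
    = monomial_ideal V {a + b | a b. a \<in> M \<and> b \<in> N}"
proof (rule equalityI)
  let ?R = "mpoly_ring V :: ('v, 'k) mpoly ring"
  let ?P = "ideal_prod ?R (monomial_ideal V M) (monomial_ideal V N)"
  interpret R: cring ?R by (rule mpoly_ring_cring)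
  have P: "additive_subgroup ?P ?R"
    by (intro ideal.axioms(1) R.ideal_prod_is_ideal ideal_monomial_ideal M N)
  show "?P \<subseteq> monomial_ideal V {a + b | a b. a \<in> M \<and> b \<in> N}"
  proof
    fix p assume "p \<in> ?P"
    then show "p \<in> monomial_ideal V {a + b | a b. a \<in> M \<and> b \<in> N}"
    proof (induction rule: ideal_prod.induct)
      case (prod p q)
      then have "p * q \<in> carrier ?R" "Poly_Mapping.keys p \<subseteq> M" "Poly_Mapping.keys q \<subseteq> N"
        using R.m_closed[of p q] by (auto simp: monomial_ideal_def mult_mpoly_ring)
      moreover have "Poly_Mapping.keys (p * q) \<subseteq> {a + b | a b. a \<in> M \<and> b \<in> N}"
        using keys_mult[of p q] calculation(2,3) by blast
      ultimately show ?case
        by (simp add: monomial_ideal_def mult_mpoly_ring)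
    next
      case (sum p q)
      then show ?case
        using R.a_closed[of p q] Poly_Mapping.keys_add[of p q]
        by (auto simp: monomial_ideal_def add_mpoly_ring)
    qed
  qed
  show "monomial_ideal V {a + b | a b. a \<in> M \<and> b \<in> N} \<subseteq> ?P"
  proof (rule monomial_ideal_subset)
    show "p + q \<in> ?P" if "p \<in> ?P" "q \<in> ?P" for p q
      using additive_subgroup.a_closed[OF P that] by (simp add: add_mpoly_ring)
    show "0 \<in> ?P"
      using additive_subgroup.zero_closed[OF P] by (simp add: zero_mpoly_ring)
    fix m and c :: 'k
    assume m: "m \<in> {a + b | a b. a \<in> M \<and> b \<in> N}" "Poly_Mapping.keys m \<subseteq> V"
    then obtain a b where ab: "m = a + b" "a \<in> M" "b \<in> N" by blast
    have "Poly_Mapping.single a c \<otimes>\<^bsub>?R\<^esub> Poly_Mapping.single b 1 \<in> ?P"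
      using m ab by (intro ideal_prod.prod) (auto simp: monomial_ideal_def carrier_mpoly_ring keys_add_nat)
    then show "Poly_Mapping.single m c \<in> ?P"
      by (simp add: mult_mpoly_ring mult_single ab)
  qed
qed

text \<open>The base case stands for the unit ideal, which is the zeroth power in
  \<open>ideals_set\<close>.\<close>

fun monomial_power :: "('v \<Rightarrow>\<^sub>0 nat) set \<Rightarrow> nat \<Rightarrow> ('v \<Rightarrow>\<^sub>0 nat) set" where
  "monomial_power M 0 = UNIV"
| "monomial_power M (Suc s) = {a + b | a b. a \<in> monomial_power M s \<and> b \<in> M}"

lemma absorbing_monomial_power:
  assumes "absorbing M"
  shows "absorbing (monomial_power M s)"
proof (induction s)
  case (Suc s)
  then show ?case
    unfolding absorbing_def by (auto simp flip: add.assoc) blast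
qed (simp add: absorbing_def)

lemma power_monomial_ideal:
  assumes M: "absorbing M"
  shows "monomial_ideal V M [^]\<^bsub>ideals_set (mpoly_ring V)\<^esub> s
    = (monomial_ideal V (monomial_power M s) :: ('v, 'k::field) mpoly set)"
proof (induction s)
  case 0
  then show ?case by (auto simp: ideals_set_def monomial_ideal_def)
next
  case (Suc s)
  then show ?case
    using ideal_prod_monomial_ideal[OF absorbing_monomial_power[OF M] M]
    by (simp add: ideals_set_def)
qed

section \<open>Primes generated by variables\<close>

text \<open>For \<open>S\<close> inside \<open>V\<close>, the monomials over \<open>V\<close> in
  this set are those of the ideal generated by the variables in \<open>S\<close>.\<close>

definition meets :: "'v set \<Rightarrow> ('v \<Rightarrow>\<^sub>0 nat) set" where
  "meets S = {m. \<exists>x \<in> S. Poly_Mapping.lookup m x > 0}"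

lemma absorbing_meets: "absorbing (meets S)"
  by (auto simp: absorbing_def meets_def lookup_add)

text \<open>The coefficient of the product at the sum of two extremal exponents comes from a single
  pair of terms: first minimise the degree in the variables \<open>S\<close>, which forces the factor from
  \<open>u\<close> to avoid \<open>S\<close>, and then break ties by a separating linear functional.\<close>

lemma monomial_ideal_cancel:
  fixes u f :: "('v, 'k::field) mpoly"
  assumes V: "finite V" and S: "S \<subseteq> V" and Q: "absorbing Q"
    and dep: "\<And>m k. \<lbrakk>k + m \<in> Q; k \<notin> meets S\<rbrakk> \<Longrightarrow> m \<in> Q"
    and u: "u \<in> carrier (mpoly_ring V)" "u \<notin> monomial_ideal V (meets S)"
    and f: "f \<in> carrier (mpoly_ring V)" and uf: "u * f \<in> monomial_ideal V Q"
  shows "f \<in> monomial_ideal V Q"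
proof (rule ccontr)
  assume "f \<notin> monomial_ideal V Q"
  define F where "F = Poly_Mapping.keys f - Q"
  define U where "U = Poly_Mapping.keys u - meets S"
  have F: "finite F" "F \<noteq> {}" and U: "finite U" "U \<noteq> {}"
    using \<open>f \<notin> _\<close> f u by (auto simp: F_def U_def monomial_ideal_def)
  define sdeg where "sdeg m = (\<Sum>x \<in> S. Poly_Mapping.lookup m x)" for m :: "'v \<Rightarrow>\<^sub>0 nat"
  have finS: "finite S" using V S finite_subset by blast
  have sdeg_add: "sdeg (a + b) = sdeg a + sdeg b" for a b
    by (simp add: sdeg_def lookup_add sum.distrib)
  have sdeg_0: "sdeg m = 0 \<longleftrightarrow> m \<notin> meets S" for m
    using finS by (auto simp: sdeg_def meets_def)
  define d where "d = Min (sdeg ` F)"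
  define F0 where "F0 = {m \<in> F. sdeg m = d}"
  have d: "d \<le> sdeg m" if "m \<in> F" for m
    using that F by (simp add: d_def)
  have "d \<in> sdeg ` F" using F by (simp add: d_def)
  then have F0: "finite F0" "F0 \<noteq> {}"
    using F by (auto simp: F0_def)
  obtain l :: "'v \<Rightarrow> nat" where
    l: "\<And>a b. \<lbrakk>a \<in> F0 \<union> U; b \<in> F0 \<union> U;
        (\<Sum>x \<in> V. Poly_Mapping.lookup a x * l x) = (\<Sum>x \<in> V. Poly_Mapping.lookup b x * l x)\<rbrakk>
        \<Longrightarrow> \<forall>x \<in> V. Poly_Mapping.lookup a x = Poly_Mapping.lookup b x"
    using separating_weights[OF V, of "Poly_Mapping.lookup ` (F0 \<union> U)"] F0 U by auto
  define w where "w m = (\<Sum>x \<in> V. Poly_Mapping.lookup m x * l x)" for m :: "'v \<Rightarrow>\<^sub>0 nat"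
  have w_add: "w (a + b) = w a + w b" for a b
    by (simp add: w_def lookup_add sum.distrib add_mult_distrib)
  have keysV: "Poly_Mapping.keys m \<subseteq> V" if "m \<in> F0 \<union> U" for m
    using that f u by (auto simp: F0_def F_def U_def carrier_mpoly_ring)
  have w_inj: "a = b" if "a \<in> F0 \<union> U" "b \<in> F0 \<union> U" "w a = w b" for a b
  proof (rule poly_mapping_eqI)
    fix x
    show "Poly_Mapping.lookup a x = Poly_Mapping.lookup b x"
    proof (cases "x \<in> V")
      case True
      then show ?thesis using l[OF that(1,2)] that(3) by (auto simp: w_def)
    next
      case False
      then have "x \<notin> Poly_Mapping.keys a" "x \<notin> Poly_Mapping.keys b"
        using keysV that by blast+
      then show ?thesis by (simp add: in_keys_iff)
    qed
  qed
  define m0 where "m0 = arg_min_on w F0"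
  define u0 where "u0 = arg_min_on w U"
  have m0: "m0 \<in> F0" "\<And>m. m \<in> F0 \<Longrightarrow> w m0 \<le> w m"
    using arg_min_if_finite(1)[OF F0] arg_min_least[OF F0] unfolding m0_def by auto
  have u0: "u0 \<in> U" "\<And>m. m \<in> U \<Longrightarrow> w u0 \<le> w m"
    using arg_min_if_finite(1)[OF U] arg_min_least[OF U] unfolding u0_def by auto
  have notQ: "u0 + m0 \<notin> Q"
    using dep[of u0 m0] u0 m0 by (auto simp: U_def F0_def F_def)
  have "Poly_Mapping.lookup (u * f) (u0 + m0) = Poly_Mapping.lookup u u0 * Poly_Mapping.lookup f m0"
  proof (rule lookup_mult_unique)
    fix a b assume a: "a \<in> Poly_Mapping.keys u" and b: "b \<in> Poly_Mapping.keys f"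
      and eq: "a + b = u0 + m0"
    \<comment> \<open>With \<open>b\<close> in \<open>Q\<close>, the sum
      \<open>a + b = u0 + m0\<close> would lie in the absorbing set \<open>Q\<close>. So
      \<open>b\<close> competes with \<open>m0\<close> for the minimal degree in
      \<open>S\<close>.\<close>
    have "b \<notin> Q" using notQ Q eq by (metis absorbing_def)
    then have bF: "b \<in> F" using b by (simp add: F_def)
    have "sdeg a + sdeg b = d"
      using arg_cong[OF eq, of sdeg] u0(1) m0(1)
      by (simp add: sdeg_add sdeg_0 U_def F0_def)
    with d[OF bF] have ab: "sdeg a = 0" "sdeg b = d" by auto
    then have aU: "a \<in> U" and bF0: "b \<in> F0"
      using a bF sdeg_0 by (auto simp: U_def F0_def)
    have "w a + w b = w u0 + w m0"
      using arg_cong[OF eq, of w] by (simp add: w_add)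
    with u0(2)[OF aU] m0(2)[OF bF0] have "w a = w u0" by simp
    then show "a = u0" using w_inj aU u0(1) by blast
  qed
  moreover have "Poly_Mapping.lookup u u0 \<noteq> 0" "Poly_Mapping.lookup f m0 \<noteq> 0"
    using u0(1) m0(1) by (auto simp: U_def F0_def F_def)
  ultimately have "u0 + m0 \<in> Poly_Mapping.keys (u * f)"
    by (simp add: in_keys_iff)
  then show False using notQ uf by (auto simp: monomial_ideal_def)
qed

text \<open>Primality is cancellation with \<open>Q = meets S\<close>: a factor without variables
  from \<open>S\<close> contributes none to a product.\<close>

lemma primeideal_variables:
  assumes "finite V" "S \<subseteq> V"
  shows "primeideal (monomial_ideal V (meets S) :: ('v, 'k::field) mpoly set) (mpoly_ring V)"
proof (rule primeidealI[OF ideal_monomial_ideal[OF absorbing_meets] mpoly_ring_cring])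
  have "1 \<in> carrier (mpoly_ring V :: ('v, 'k) mpoly ring)"
    and "1 \<notin> (monomial_ideal V (meets S) :: ('v, 'k) mpoly set)"
    by (auto simp: monomial_ideal_def carrier_mpoly_ring meets_def)
  then show "carrier (mpoly_ring V) \<noteq> (monomial_ideal V (meets S) :: ('v, 'k) mpoly set)"
    by blast
  have dep: "m \<in> meets S" if "k + m \<in> meets S" "k \<notin> meets S" for k m
    using that by (auto simp: meets_def lookup_add)
  fix p q :: "('v, 'k) mpoly"
  assume p: "p \<in> carrier (mpoly_ring V)" and q: "q \<in> carrier (mpoly_ring V)"
    and "p \<otimes>\<^bsub>mpoly_ring V\<^esub> q \<in> monomial_ideal V (meets S)"
  then have pq: "p * q \<in> monomial_ideal V (meets S)"
    by (simp add: mult_mpoly_ring)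
  have "q \<in> monomial_ideal V (meets S)" if "p \<notin> monomial_ideal V (meets S)"
    by (rule monomial_ideal_cancel[OF assms absorbing_meets _ p that q pq]) (rule dep)
  then show "p \<in> monomial_ideal V (meets S) \<or> q \<in> monomial_ideal V (meets S)"
    by blast
qed

lemma keys_mult_single:
  fixes p :: "('v, 'k::field) mpoly"
  shows "Poly_Mapping.keys (p * Poly_Mapping.single m 1) = (\<lambda>k. k + m) ` Poly_Mapping.keys p"
proof (rule equalityI)
  show "Poly_Mapping.keys (p * Poly_Mapping.single m 1) \<subseteq> (\<lambda>k. k + m) ` Poly_Mapping.keys p"
    using keys_mult[of p "Poly_Mapping.single m 1"] by auto
  have "Poly_Mapping.lookup (p * Poly_Mapping.single m 1) (k + m) = Poly_Mapping.lookup p k" for k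
    by (subst lookup_mult_unique) auto
  then show "(\<lambda>k. k + m) ` Poly_Mapping.keys p \<subseteq> Poly_Mapping.keys (p * Poly_Mapping.single m 1)"
    by (auto simp: in_keys_iff)
qed

text \<open>Multiplying by a monomial shifts the exponents without cancellation, so a colon by a
  monomial is decided exponent by exponent.\<close>

lemma colon_monomial:
  assumes "Poly_Mapping.keys m \<subseteq> V" and "\<And>k. k + m \<in> M \<longleftrightarrow> k \<in> meets S"
  shows "{r \<in> carrier (mpoly_ring V). r \<otimes>\<^bsub>mpoly_ring V\<^esub> Poly_Mapping.single m 1 \<in> monomial_ideal V M}
    = (monomial_ideal V (meets S) :: ('v, 'k::field) mpoly set)"
  using assms by (auto simp: monomial_ideal_def mult_mpoly_ring keys_mult_single carrier_mpoly_ring keys_add_nat)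

section \<open>Bounds for symbolic powers\<close>

text \<open>The colon by the monomial \<open>x\<close> is the prime of the variables
  \<open>S\<close>, which is therefore associated. So every \<open>f\<close> in the symbolic power
  is multiplied into the ordinary power by some \<open>u\<close> outside this prime, and
  \<open>dep\<close> allows \<open>u\<close> to be cancelled modulo the larger ideal given by
  \<open>Q\<close>.\<close>

lemma symbolic_power_monomial_ideal_subset:
  fixes M Q :: "('v \<Rightarrow>\<^sub>0 nat) set"
  assumes V: "finite V" and S: "S \<subseteq> V" and M: "absorbing M"
    and x: "Poly_Mapping.keys x \<subseteq> V" "\<And>k. k + x \<in> M \<longleftrightarrow> k \<in> meets S"
    and Q: "absorbing Q" "monomial_power M s \<subseteq> Q"
    and dep: "\<And>m k. \<lbrakk>k + m \<in> Q; k \<notin> meets S\<rbrakk> \<Longrightarrow> m \<in> Q"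
  shows "symbolic_power (mpoly_ring V) (monomial_ideal V M) s
    \<subseteq> (monomial_ideal V Q :: ('v, 'k::field) mpoly set)"
proof
  let ?R = "mpoly_ring V :: ('v, 'k) mpoly ring"
  let ?P = "monomial_ideal V (meets S) :: ('v, 'k) mpoly set"
  fix f assume f: "f \<in> symbolic_power ?R (monomial_ideal V M) s"
  have "?P \<in> associated_primes ?R (monomial_ideal V M)"
  proof -
    have "Poly_Mapping.single x 1 \<in> carrier ?R"
      using x(1) by (simp add: carrier_mpoly_ring)
    then show ?thesis
      using colon_associated_prime[OF ideal_monomial_ideal[OF M], of "Poly_Mapping.single x 1" V,
          unfolded colon_monomial[OF x], OF _ primeideal_variables[OF V S]]
      by blast
  qed
  then obtain u where u: "u \<in> carrier ?R" "u \<notin> ?P" "u * f \<in> monomial_ideal V (monomial_power M s)"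
    and fR: "f \<in> carrier ?R"
    using f unfolding power_monomial_ideal[OF M]
      symbolic_power_eq[where R = ?R and I = "monomial_ideal V M" and s = s, unfolded power_monomial_ideal[OF M],
        OF ideal_monomial_ideal[OF absorbing_monomial_power[OF M]]]
    by (auto simp: mult_mpoly_ring)
  have "u * f \<in> monomial_ideal V Q"
    using u(3) Q(2) by (auto simp: monomial_ideal_def)
  then show "f \<in> monomial_ideal V Q"
    using monomial_ideal_cancel[OF V S Q(1) _ u(1,2) fR] dep by blast
qed

text \<open>The denominator one serves every associated prime.\<close>

lemma power_subset_symbolic_power:
  assumes "cring R" "ideal (I [^]\<^bsub>ideals_set R\<^esub> s) R"
  shows "I [^]\<^bsub>ideals_set R\<^esub> s \<subseteq> symbolic_power R I s"
proof
  interpret cring R by fact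
  fix a assume a: "a \<in> I [^]\<^bsub>ideals_set R\<^esub> s"
  then have "a \<in> carrier R" using ideal.Icarr[OF assms(2)] by blast
  moreover have "\<exists>u \<in> carrier R - P. u \<otimes>\<^bsub>R\<^esub> a \<in> I [^]\<^bsub>ideals_set R\<^esub> s"
    if "P \<in> associated_primes R I" for P
    using that a \<open>a \<in> carrier R\<close> primeideal.one_in_compl[of P R]
    by (intro bexI[of _ "\<one>\<^bsub>R\<^esub>"]) (auto simp: associated_primes_def)
  ultimately show "a \<in> symbolic_power R I s"
    unfolding symbolic_power_eq[OF assms(2)] by blast
qed

section \<open>Ordinary powers of the edge ideal of a star\<close>

text \<open>The center is \<open>c\<close>; the edges are \<open>(a, c)\<close> for \<open>a \<in> A\<close> and \<open>(c, b)\<close> for \<open>b \<in> B\<close>.\<close>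

locale weighted_star =
  fixes c :: 'v and A B :: "'v set" and wt :: "'v \<Rightarrow> nat"
  assumes finite_A: "finite A" and finite_B: "finite B"
    and c_notin_A: "c \<notin> A" and c_notin_B: "c \<notin> B" and disjoint: "A \<inter> B = {}"
    and wt_c: "wt c \<ge> 1" and wt_B: "\<And>b. b \<in> B \<Longrightarrow> wt b \<ge> 1"
begin

definition star_gens :: "('v \<Rightarrow>\<^sub>0 nat) set" where
  "star_gens = {Poly_Mapping.single a 1 + Poly_Mapping.single c (wt c) | a. a \<in> A}
    \<union> {Poly_Mapping.single c 1 + Poly_Mapping.single b (wt b) | b. b \<in> B}"

definition star_monomials :: "('v \<Rightarrow>\<^sub>0 nat) set" where
  "star_monomials = {k + g | k g. g \<in> star_gens}"

text \<open>\<open>alpha m\<close> and \<open>beta m\<close> are the orders of the monomial \<open>m\<close> along the ideals generated by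
  \<open>a\<close> for \<open>a \<in> A\<close> and by \<open>b ^ wt b\<close> for \<open>b \<in> B\<close>.\<close>

definition alpha :: "('v \<Rightarrow>\<^sub>0 nat) \<Rightarrow> nat" where
  "alpha m = (\<Sum>a \<in> A. Poly_Mapping.lookup m a)"

definition beta :: "('v \<Rightarrow>\<^sub>0 nat) \<Rightarrow> nat" where
  "beta m = (\<Sum>b \<in> B. Poly_Mapping.lookup m b div wt b)"

lemma absorbing_star_monomials: "absorbing star_monomials"
  unfolding absorbing_def star_monomials_def by (auto simp flip: add.assoc) blast

lemma star_monomialsI: "g \<in> star_gens \<Longrightarrow> k + g \<in> star_monomials"
  by (auto simp: star_monomials_def)

lemma mem_star_monomials_iff:
  "m \<in> star_monomials \<longleftrightarrow>
    (\<exists>a \<in> A. 1 \<le> Poly_Mapping.lookup m a \<and> wt c \<le> Poly_Mapping.lookup m c) \<or>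
    (\<exists>b \<in> B. wt b \<le> Poly_Mapping.lookup m b \<and> 1 \<le> Poly_Mapping.lookup m c)"
  (is "?L \<longleftrightarrow> ?R")
proof
  assume ?L
  then obtain k g where "m = k + g" "g \<in> star_gens"
    by (auto simp: star_monomials_def)
  then show ?R
    using c_notin_A c_notin_B by (fastforce simp: star_gens_def lookup_add lookup_single when_def)
next
  assume ?R
  then show ?L
  proof (elim disjE bexE conjE)
    fix a assume a: "a \<in> A" "1 \<le> Poly_Mapping.lookup m a" "wt c \<le> Poly_Mapping.lookup m c"
    let ?g = "Poly_Mapping.single a 1 + Poly_Mapping.single c (wt c)"
    have "(m - ?g) + ?g = m"
      using a c_notin_A by (intro minus_add_monomial) (auto simp: lookup_add lookup_single when_def)
    moreover have "?g \<in> star_gens" using a by (auto simp: star_gens_def)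
    ultimately show ?L using star_monomialsI[of ?g "m - ?g"] by simp
  next
    fix b assume b: "b \<in> B" "wt b \<le> Poly_Mapping.lookup m b" "1 \<le> Poly_Mapping.lookup m c"
    let ?g = "Poly_Mapping.single c 1 + Poly_Mapping.single b (wt b)"
    have "(m - ?g) + ?g = m"
      using b c_notin_B by (intro minus_add_monomial) (auto simp: lookup_add lookup_single when_def)
    moreover have "?g \<in> star_gens" using b by (auto simp: star_gens_def)
    ultimately show ?L using star_monomialsI[of ?g "m - ?g"] by simp
  qed
qed

lemma alpha_add: "alpha (k + m) = alpha k + alpha m"
  by (simp add: alpha_def lookup_add sum.distrib)

text \<open>Rounding down is superadditive but in general not additive, since remainders may add up
  to a further \<open>wt b\<close>.\<close>

lemma beta_add: "beta k + beta m \<le> beta (k + m)"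
proof -
  have "p div n + q div n \<le> (p + q) div n" for p q n :: nat
    using div_add1_eq[of p q n] by simp
  then show ?thesis
    unfolding beta_def lookup_add sum.distrib[symmetric] by (intro sum_mono)
qed

lemma alpha_cong: "(\<And>a. a \<in> A \<Longrightarrow> Poly_Mapping.lookup k a = Poly_Mapping.lookup m a) \<Longrightarrow> alpha k = alpha m"
  and beta_cong: "(\<And>b. b \<in> B \<Longrightarrow> Poly_Mapping.lookup k b = Poly_Mapping.lookup m b) \<Longrightarrow> beta k = beta m"
  by (simp_all add: alpha_def beta_def)

lemma alpha_pos: "alpha m \<ge> 1 \<longleftrightarrow> (\<exists>a \<in> A. Poly_Mapping.lookup m a \<ge> 1)"
proof -
  have "alpha m = 0 \<longleftrightarrow> (\<forall>a \<in> A. Poly_Mapping.lookup m a = 0)"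
    using finite_A by (simp add: alpha_def)
  then show ?thesis by (metis less_one not_le)
qed

lemma beta_pos: "beta m \<ge> 1 \<longleftrightarrow> (\<exists>b \<in> B. Poly_Mapping.lookup m b \<ge> wt b)"
proof -
  have "beta m = 0 \<longleftrightarrow> (\<forall>b \<in> B. Poly_Mapping.lookup m b < wt b)"
    using finite_B wt_B by (fastforce simp: beta_def div_eq_0_iff)
  then show ?thesis by (metis less_one not_le)
qed

lemma in_edge_values:
  assumes "a \<in> A" and "m = k + (Poly_Mapping.single a 1 + Poly_Mapping.single c (wt c))"
  shows "alpha m = Suc (alpha k)" "beta m = beta k"
    "Poly_Mapping.lookup m c = Poly_Mapping.lookup k c + wt c"
proof -
  have "alpha (Poly_Mapping.single a 1 + Poly_Mapping.single c (wt c)) = (\<Sum>x \<in> A. if x = a then 1 else 0)"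
    unfolding alpha_def using c_notin_A
    by (intro sum.cong) (auto simp: lookup_add lookup_single when_def)
  also have "\<dots> = 1"
    using assms(1) finite_A by simp
  finally show "alpha m = Suc (alpha k)" by (simp add: alpha_add assms(2))
  show "beta m = beta k"
    using assms(1) disjoint c_notin_B
    by (intro beta_cong) (auto simp: assms(2) lookup_add lookup_single when_def)
  show "Poly_Mapping.lookup m c = Poly_Mapping.lookup k c + wt c"
    using assms c_notin_A by (auto simp: lookup_add lookup_single when_def)
qed

text \<open>Adding the full \<open>wt b\<close> at \<open>b\<close> keeps the remainder and raises
  the quotient by exactly one, as \<open>wt b\<close> is positive.\<close>

lemma out_edge_values:
  assumes "b \<in> B" and "m = k + (Poly_Mapping.single c 1 + Poly_Mapping.single b (wt b))"
  shows "alpha m = alpha k" "beta m = Suc (beta k)"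
    "Poly_Mapping.lookup m c = Suc (Poly_Mapping.lookup k c)"
proof -
  show "alpha m = alpha k"
    using assms(1) disjoint c_notin_A
    by (intro alpha_cong) (auto simp: assms(2) lookup_add lookup_single when_def)
  have "beta m = (\<Sum>x \<in> B. Poly_Mapping.lookup k x div wt x + (if x = b then 1 else 0))"
    unfolding beta_def
  proof (rule sum.cong[OF refl])
    fix x assume x: "x \<in> B"
    then have "wt x \<noteq> 0" using wt_B[of x] by simp
    then show "Poly_Mapping.lookup m x div wt x
        = Poly_Mapping.lookup k x div wt x + (if x = b then 1 else 0)"
      using x c_notin_B by (auto simp: assms(2) div_add_self2 lookup_add lookup_single when_def)
  qed
  then show "beta m = Suc (beta k)"
    using assms(1) finite_B by (simp add: beta_def sum.distrib)
  show "Poly_Mapping.lookup m c = Suc (Poly_Mapping.lookup k c)"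
    using assms c_notin_B by (auto simp: lookup_add lookup_single when_def)
qed

text \<open>Here \<open>i\<close> counts factors from edges into \<open>c\<close> and
  \<open>j\<close> factors from edges out of \<open>c\<close>. The two kinds use different leaves
  and compete only for the exponent of \<open>c\<close>, where they cost \<open>wt c\<close> and 1.
  The induction removes one generator at a time.\<close>

lemma monomial_power_star_monomials_iff:
  "m \<in> monomial_power star_monomials s \<longleftrightarrow>
    (\<exists>i j. i + j = s \<and> wt c * i + j \<le> Poly_Mapping.lookup m c \<and> i \<le> alpha m \<and> j \<le> beta m)"
proof (induction s arbitrary: m)
  case 0
  then show ?case by auto
next
  case (Suc s)
  show ?case
  proof
    assume "m \<in> monomial_power star_monomials (Suc s)"
    then obtain k l g where m: "m = (k + l) + g" "k \<in> monomial_power star_monomials s" "g \<in> star_gens"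
      by (auto simp: star_monomials_def add.assoc)
    \<comment> \<open>The cofactor \<open>l\<close> of the last generator is moved to the other
      factors, which absorb it.\<close>
    have "k + l \<in> monomial_power star_monomials s"
      using absorbing_monomial_power[OF absorbing_star_monomials] m(2)
      by (metis absorbing_def add.commute)
    then obtain i j where ij: "i + j = s" "wt c * i + j \<le> Poly_Mapping.lookup (k + l) c"
      "i \<le> alpha (k + l)" "j \<le> beta (k + l)"
      using Suc.IH by blast
    from m(3) show "\<exists>i j. i + j = Suc s \<and> wt c * i + j \<le> Poly_Mapping.lookup m c \<and> i \<le> alpha m \<and> j \<le> beta m"
      unfolding star_gens_def
    proof (elim UnE CollectE exE conjE)
      fix a assume a: "a \<in> A" "g = Poly_Mapping.single a 1 + Poly_Mapping.single c (wt c)"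
      show ?thesis
        using in_edge_values[OF a(1) m(1)[unfolded a(2)]] ij
        by (intro exI[of _ "Suc i"] exI[of _ j]) auto
    next
      fix b assume b: "b \<in> B" "g = Poly_Mapping.single c 1 + Poly_Mapping.single b (wt b)"
      show ?thesis
        using out_edge_values[OF b(1) m(1)[unfolded b(2)]] ij
        by (intro exI[of _ i] exI[of _ "Suc j"]) auto
    qed
  next
    assume "\<exists>i j. i + j = Suc s \<and> wt c * i + j \<le> Poly_Mapping.lookup m c \<and> i \<le> alpha m \<and> j \<le> beta m"
    then obtain i j where ij: "i + j = Suc s" "wt c * i + j \<le> Poly_Mapping.lookup m c"
      "i \<le> alpha m" "j \<le> beta m" by blast
    have step: "m \<in> monomial_power star_monomials (Suc s)"
      if "m = k + g" "g \<in> star_gens" "k \<in> monomial_power star_monomials s" for k g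
    proof -
      have "g \<in> star_monomials"
        using star_monomialsI[OF that(2), of 0] by simp
      then show ?thesis using that by auto
    qed
    \<comment> \<open>If \<open>i\<close> is positive, an edge into \<open>c\<close> is split off.
      Otherwise \<open>j = Suc s\<close>, and \<open>beta m\<close> supplies an edge out of
      \<open>c\<close>.\<close>
    show "m \<in> monomial_power star_monomials (Suc s)"
    proof (cases i)
      case (Suc i')
      then obtain a where a: "a \<in> A" "1 \<le> Poly_Mapping.lookup m a"
        using ij alpha_pos[of m] by auto
      let ?g = "Poly_Mapping.single a 1 + Poly_Mapping.single c (wt c)"
      have "(m - ?g) + ?g = m"
        using a c_notin_A ij Suc by (intro minus_add_monomial) (auto simp: lookup_add lookup_single when_def)
      then have m: "m = (m - ?g) + ?g" by simp
      show ?thesis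
      proof (rule step[OF m])
        show "?g \<in> star_gens" using a by (auto simp: star_gens_def)
        show "m - ?g \<in> monomial_power star_monomials s"
          unfolding Suc.IH using in_edge_values[OF a(1) m] ij Suc
          by (intro exI[of _ i'] exI[of _ j]) auto
      qed
    next
      case 0
      then obtain b where b: "b \<in> B" "wt b \<le> Poly_Mapping.lookup m b"
        using ij beta_pos[of m] by auto
      let ?g = "Poly_Mapping.single c 1 + Poly_Mapping.single b (wt b)"
      have "(m - ?g) + ?g = m"
        using b c_notin_B ij 0 by (intro minus_add_monomial) (auto simp: lookup_add lookup_single when_def)
      then have m: "m = (m - ?g) + ?g" by simp
      show ?thesis
      proof (rule step[OF m])
        show "?g \<in> star_gens" using b by (auto simp: star_gens_def)
        show "m - ?g \<in> monomial_power star_monomials s"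
          unfolding Suc.IH using out_edge_values[OF b(1) m] ij 0
          by (intro exI[of _ 0] exI[of _ s]) auto
      qed
    qed
  qed
qed

section \<open>The conditions left by the two localizations\<close>

text \<open>Each exponent is one short: a monomial times \<open>tops\<close> is divisible by
  \<open>b ^ wt b\<close> iff the monomial itself is divisible by \<open>b\<close>.\<close>

definition tops :: "'v \<Rightarrow>\<^sub>0 nat" where
  "tops = (\<Sum>b \<in> B. Poly_Mapping.single b (wt b - 1))"

lemma lookup_tops: "Poly_Mapping.lookup tops x = (if x \<in> B then wt x - 1 else 0)"
  using finite_B by (simp add: tops_def lookup_sum lookup_single when_def)

text \<open>The inequality says that \<open>s = i + j\<close> for some
  \<open>i \<le> alpha m\<close> and \<open>j \<le> beta m\<close>; the bound at \<open>c\<close>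
  disappears once \<open>c\<close> is inverted.\<close>

definition leaves_cond :: "nat \<Rightarrow> ('v \<Rightarrow>\<^sub>0 nat) set" where
  "leaves_cond s = {m. s \<le> alpha m + beta m}"

definition center_cond :: "nat \<Rightarrow> ('v \<Rightarrow>\<^sub>0 nat) set" where
  "center_cond s = {m. \<exists>i j. i + j = s \<and> wt c * i + j \<le> Poly_Mapping.lookup m c \<and> j \<le> beta m}"

text \<open>Raising \<open>j0\<close> to \<open>min s (beta m)\<close> trades \<open>d\<close> edges
  into \<open>c\<close> for \<open>d\<close> edges out of \<open>c\<close>, which does not increase
  the exponent needed at \<open>c\<close> because \<open>wt c \<ge> 1\<close>. The remaining
  \<open>s - j\<close> is at most \<open>alpha m\<close> by the condition on the leaves.\<close>

lemma conds_imp_monomial_power: "leaves_cond s \<inter> center_cond s \<subseteq> monomial_power star_monomials s"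
proof
  fix m assume m: "m \<in> leaves_cond s \<inter> center_cond s"
  then obtain i0 j0 where ij: "i0 + j0 = s" "wt c * i0 + j0 \<le> Poly_Mapping.lookup m c" "j0 \<le> beta m"
    and s: "s \<le> alpha m + beta m"
    by (auto simp: leaves_cond_def center_cond_def)
  define j where "j = min s (beta m)"
  define d where "d = j - j0"
  have j: "j = j0 + d" "i0 = (s - j) + d" "j \<le> s" "s - j \<le> alpha m"
    using ij s by (auto simp: j_def d_def)
  have "wt c * (s - j) + j \<le> wt c * i0 + j0"
  proof -
    have "wt c * i0 = wt c * (s - j) + wt c * d"
      by (metis add_mult_distrib2 j(2))
    moreover have "d \<le> wt c * d" using wt_c by simp
    ultimately show ?thesis using j(1) by linarith
  qed
  then show "m \<in> monomial_power star_monomials s"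
    unfolding monomial_power_star_monomials_iff using ij j
    by (intro exI[of _ "s - j"] exI[of _ j]) (auto simp: j_def)
qed

lemma symbolic_power_leaves:
  assumes V: "finite V" "insert c (A \<union> B) \<subseteq> V"
  shows "symbolic_power (mpoly_ring V) (monomial_ideal V star_monomials) s
    \<subseteq> (monomial_ideal V (leaves_cond s) :: ('v, 'k::field) mpoly set)"
proof (rule symbolic_power_monomial_ideal_subset[OF V(1) _ absorbing_star_monomials])
  \<comment> \<open>The power of \<open>c\<close> meets the demand of every generator at the center,
    and \<open>tops\<close> is one short at each leaf in \<open>B\<close>. So any further leaf
    variable, and nothing else, completes a generator.\<close>
  let ?x = "Poly_Mapping.single c (wt c) + tops"
  show "A \<union> B \<subseteq> V" using V by blast
  show "Poly_Mapping.keys ?x \<subseteq> V"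
    using V by (auto simp: in_keys_iff lookup_add lookup_single lookup_tops when_def split: if_splits)
  fix k
  have "wt b \<le> Poly_Mapping.lookup k b + (wt b - 1) \<longleftrightarrow> 0 < Poly_Mapping.lookup k b" if "b \<in> B" for b
    using wt_B[OF that] by auto
  moreover have "Poly_Mapping.lookup (k + ?x) c = Poly_Mapping.lookup k c + wt c"
    using c_notin_B by (simp add: lookup_add lookup_tops)
  moreover have "Poly_Mapping.lookup (k + ?x) a = Poly_Mapping.lookup k a" if "a \<in> A" for a
    using that c_notin_A disjoint by (auto simp: lookup_add lookup_single lookup_tops when_def)
  moreover have "Poly_Mapping.lookup (k + ?x) b = Poly_Mapping.lookup k b + (wt b - 1)" if "b \<in> B" for b
    using that c_notin_B by (auto simp: lookup_add lookup_single lookup_tops when_def)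
  ultimately show "k + ?x \<in> star_monomials \<longleftrightarrow> k \<in> meets (A \<union> B)"
    using wt_c unfolding mem_star_monomials_iff meets_def by force
next
  show "absorbing (leaves_cond s)"
    unfolding absorbing_def leaves_cond_def
  proof clarify
    fix m k assume "s \<le> alpha m + beta m"
    then show "s \<le> alpha (k + m) + beta (k + m)"
      using beta_add[of k m] by (simp add: alpha_add)
  qed
  show "monomial_power star_monomials s \<subseteq> leaves_cond s"
    by (auto simp: monomial_power_star_monomials_iff leaves_cond_def)
  fix m k assume "k + m \<in> leaves_cond s" "k \<notin> meets (A \<union> B)"
  then show "m \<in> leaves_cond s"
    using alpha_cong[of "k + m" m] beta_cong[of "k + m" m]
    by (auto simp: leaves_cond_def meets_def lookup_add)
qed

lemma absorbing_center_cond: "absorbing (center_cond s)"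
  unfolding absorbing_def center_cond_def
proof clarify
  fix m k i j
  assume "wt c * i + j \<le> Poly_Mapping.lookup m c" "j \<le> beta m"
  then show "\<exists>i' j'. i' + j' = i + j \<and> wt c * i' + j' \<le> Poly_Mapping.lookup (k + m) c \<and> j' \<le> beta (k + m)"
    using beta_add[of k m] by (intro exI[of _ i] exI[of _ j]) (auto simp: lookup_add)
qed

lemma monomial_power_subset_center_cond: "monomial_power star_monomials s \<subseteq> center_cond s"
  unfolding monomial_power_star_monomials_iff center_cond_def subset_iff by blast

text \<open>If \<open>wt c = 1\<close>, the condition on \<open>beta\<close> is void and comes from localizing at \<open>(c)\<close>.
  Otherwise the embedded prime generated by \<open>c\<close> and \<open>B\<close> is associated and gives it.\<close>

lemma symbolic_power_center:
  assumes V: "finite V" "insert c (A \<union> B) \<subseteq> V" and ne: "A \<union> B \<noteq> {}" and src: "A = {} \<Longrightarrow> wt c = 1"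
  shows "symbolic_power (mpoly_ring V) (monomial_ideal V star_monomials) s
    \<subseteq> (monomial_ideal V (center_cond s) :: ('v, 'k::field) mpoly set)"
proof (cases "wt c = 1")
  case True
  \<comment> \<open>With \<open>wt c = 1\<close> every generator contains \<open>c\<close> to the
    first power. The leaf part of any one generator therefore has colon \<open>(c)\<close>.\<close>
  obtain x where x: "Poly_Mapping.keys x \<subseteq> V" "\<And>k. k + x \<in> star_monomials \<longleftrightarrow> k \<in> meets {c}"
  proof (cases "A = {}")
    case False
    then obtain a where a: "a \<in> A" by blast
    show thesis
    proof (rule that)
      show "Poly_Mapping.keys (Poly_Mapping.single a (1::nat)) \<subseteq> V" using a V by auto
      show "k + Poly_Mapping.single a 1 \<in> star_monomials \<longleftrightarrow> k \<in> meets {c}" for k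
        using a c_notin_A True unfolding mem_star_monomials_iff
        by (auto simp: meets_def lookup_add lookup_single when_def)
    qed
  next
    case A: True
    then obtain b where b: "b \<in> B" using ne by blast
    show thesis
    proof (rule that)
      show "Poly_Mapping.keys (Poly_Mapping.single b (wt b)) \<subseteq> V" using b V by auto
      show "k + Poly_Mapping.single b (wt b) \<in> star_monomials \<longleftrightarrow> k \<in> meets {c}" for k
        using A b c_notin_B unfolding mem_star_monomials_iff
        by (auto simp: meets_def lookup_add lookup_single when_def)
    qed
  qed
  show ?thesis
  proof (rule symbolic_power_monomial_ideal_subset[OF V(1) _ absorbing_star_monomials x
        absorbing_center_cond monomial_power_subset_center_cond])
    show "{c} \<subseteq> V" using V by blast
    have "center_cond s = {m. s \<le> Poly_Mapping.lookup m c}"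
    proof (intro equalityI subsetI)
      fix m assume "m \<in> {m. s \<le> Poly_Mapping.lookup m c}"
      then show "m \<in> center_cond s"
        using True unfolding center_cond_def by (intro CollectI exI[of _ s] exI[of _ 0]) auto
    qed (use True in \<open>auto simp: center_cond_def\<close>)
    then show "m \<in> center_cond s" if "k + m \<in> center_cond s" "k \<notin> meets {c}" for m k
      using that by (auto simp: meets_def lookup_add)
  qed
next
  case False
  then have w: "wt c \<ge> 2" using wt_c by simp
  \<comment> \<open>The source convention enters here: a center of weight at least 2 has an incoming
    edge.\<close>
  from False src obtain a where a: "a \<in> A" by blast
  \<comment> \<open>This monomial lacks one \<open>c\<close> for the edge from \<open>a\<close> and
    one \<open>b\<close> for each edge to \<open>B\<close>. Since \<open>wt c - 1\<close> is
    positive, the edges to \<open>B\<close> need no further \<open>c\<close>. So exactly the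
    variables \<open>c\<close> and \<open>b \<in> B\<close> complete a generator.\<close>
  let ?x = "Poly_Mapping.single a 1 + Poly_Mapping.single c (wt c - 1) + tops"
  show ?thesis
  proof (rule symbolic_power_monomial_ideal_subset[OF V(1) _ absorbing_star_monomials _ _
        absorbing_center_cond monomial_power_subset_center_cond])
    show "insert c B \<subseteq> V" using V by blast
    show "Poly_Mapping.keys ?x \<subseteq> V"
      using V a by (auto simp: in_keys_iff lookup_add lookup_single lookup_tops when_def split: if_splits)
    show "k + ?x \<in> star_monomials \<longleftrightarrow> k \<in> meets (insert c B)" for k
    proof -
      have "wt b \<le> Poly_Mapping.lookup k b + (wt b - 1) \<longleftrightarrow> 0 < Poly_Mapping.lookup k b" if "b \<in> B" for b
        using wt_B[OF that] by auto
      moreover have "Poly_Mapping.lookup (k + ?x) c = Poly_Mapping.lookup k c + (wt c - 1)"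
        "Poly_Mapping.lookup (k + ?x) a \<ge> 1"
        using a c_notin_A c_notin_B disjoint by (auto simp: lookup_add lookup_single lookup_tops when_def)
      moreover have "Poly_Mapping.lookup (k + ?x) b = Poly_Mapping.lookup k b + (wt b - 1)" if "b \<in> B" for b
        using that a c_notin_B disjoint by (auto simp: lookup_add lookup_single lookup_tops when_def)
      ultimately show ?thesis
        using a w unfolding mem_star_monomials_iff meets_def by force
    qed
    fix m k assume km: "k + m \<in> center_cond s" "k \<notin> meets (insert c B)"
    then have "Poly_Mapping.lookup (k + m) c = Poly_Mapping.lookup m c" "beta (k + m) = beta m"
      by (auto simp: meets_def lookup_add intro!: beta_cong)
    with km(1) show "m \<in> center_cond s" by (simp add: center_cond_def)
  qed
qed

text \<open>The bounds from the two primes intersect in the ordinary power. The last hypothesis is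
  the source convention for the center.\<close>

lemma symbolic_power_star_monomials:
  assumes "finite V" "insert c (A \<union> B) \<subseteq> V" "A \<union> B \<noteq> {}" "A = {} \<Longrightarrow> wt c = 1"
  shows "symbolic_power (mpoly_ring V) (monomial_ideal V star_monomials :: ('v, 'k::field) mpoly set) s
    = monomial_ideal V star_monomials [^]\<^bsub>ideals_set (mpoly_ring V)\<^esub> s"
proof (rule equalityI)
  let ?I = "monomial_ideal V star_monomials :: ('v, 'k) mpoly set"
  have "monomial_ideal V (leaves_cond s) \<inter> monomial_ideal V (center_cond s)
      \<subseteq> (monomial_ideal V (monomial_power star_monomials s) :: ('v, 'k) mpoly set)"
    using conds_imp_monomial_power by (auto simp: monomial_ideal_def)
  then show "symbolic_power (mpoly_ring V) ?I s \<subseteq> ?I [^]\<^bsub>ideals_set (mpoly_ring V)\<^esub> s"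
    using symbolic_power_leaves[OF assms(1,2), of s, where ?'k = 'k]
      symbolic_power_center[OF assms, of s, where ?'k = 'k]
    unfolding power_monomial_ideal[OF absorbing_star_monomials] by blast
  show "?I [^]\<^bsub>ideals_set (mpoly_ring V)\<^esub> s \<subseteq> symbolic_power (mpoly_ring V) ?I s"
    by (rule power_subset_symbolic_power[OF mpoly_ring_cring])
      (simp add: power_monomial_ideal absorbing_star_monomials ideal_monomial_ideal absorbing_monomial_power)
qed

end

section \<open>From oriented star graphs to the monomial description\<close>

lemma mvar_power: "mvar x ^ n = Poly_Mapping.single (Poly_Mapping.single x n) (1::'k::field)"
  by (induction n) (simp_all add: mvar_def mult_single single_add[symmetric])

text \<open>Since \<open>c\<close> has degree \<open>n\<close> and there are \<open>n\<close> other
  vertices, it is joined to all of them. An edge avoiding \<open>c\<close> would be a second edge at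
  its endpoints, which have degree one.\<close>

lemma star_graph_center:
  assumes "finite V" and F: "\<And>e. e \<in> F \<Longrightarrow> \<exists>x \<in> V. \<exists>y \<in> V. x \<noteq> y \<and> e = {x, y}"
    and star: "star_graph n V F"
  shows "\<exists>c \<in> V. F = (\<lambda>v. {c, v}) ` (V - {c})"
proof -
  from star obtain c where c: "c \<in> V" "graph_degree F c = n" "card V = n + 1"
    "\<And>v. v \<in> V - {c} \<Longrightarrow> graph_degree F v = 1"
    by (auto simp: star_graph_def)
  let ?E = "(\<lambda>v. {c, v}) ` (V - {c})"
  have "{e \<in> F. c \<in> e} \<subseteq> ?E"
    using F by (fastforce simp: doubleton_eq_iff)
  moreover have "card ?E = n"
  proof -
    have "inj_on (\<lambda>v. {c, v}) (V - {c})" by (auto simp: inj_on_def doubleton_eq_iff)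
    then show ?thesis using c assms(1) by (simp add: card_image)
  qed
  ultimately have E: "{e \<in> F. c \<in> e} = ?E"
    using c(2) assms(1) by (intro card_subset_eq) (auto simp: graph_degree_def)
  have "c \<in> e" if e: "e \<in> F" for e
  proof (rule ccontr)
    assume "c \<notin> e"
    with F[OF e] obtain x y where x: "x \<in> V - {c}" "e = {x, y}" by auto
    have "{c, x} \<in> F" using E x(1) by blast
    from c(4)[OF x(1)] obtain e' where e': "{e \<in> F. x \<in> e} = {e'}"
      unfolding graph_degree_def by (auto simp: card_1_singleton_iff)
    have "e \<in> {e \<in> F. x \<in> e}" "{c, x} \<in> {e \<in> F. x \<in> e}"
      using e x \<open>{c, x} \<in> F\<close> by auto
    then have "e = {c, x}" unfolding e' by simp
    with \<open>c \<notin> e\<close> show False by blast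
  qed
  with E have "F = ?E" by blast
  with c(1) show ?thesis by blast
qed

theorem theorem4p12:
  fixes D :: "'v wo_graph" and n s :: nat
  assumes "weighted_oriented_graph D"
    and "n \<ge> 2"
    and "star_graph n (verts D) (underlying_edges D)"
    and "s \<ge> 2"
  shows "symbolic_power (mpoly_ring (verts D)) (edge_ideal D :: ('v, 'k::field) mpoly set) s
       = edge_ideal D [^]\<^bsub>ideals_set (mpoly_ring (verts D))\<^esub> s"
proof -
  let ?V = "verts D"
  have D: "finite ?V" "edges D \<subseteq> ?V \<times> ?V" "\<And>x y. (x, y) \<in> edges D \<Longrightarrow> x \<noteq> y \<and> (y, x) \<notin> edges D"
    "\<And>x. x \<in> ?V \<Longrightarrow> weight D x \<ge> 1" "\<And>x. is_source D x \<Longrightarrow> weight D x = 1"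
    using assms(1) by (auto simp: weighted_oriented_graph_def)
  have "\<exists>x \<in> ?V. \<exists>y \<in> ?V. x \<noteq> y \<and> e = {x, y}" if "e \<in> underlying_edges D" for e
    using that D(2,3) by (fastforce simp: underlying_edges_def)
  from star_graph_center[OF D(1) this assms(3)] obtain c
    where c: "c \<in> ?V" and star: "underlying_edges D = (\<lambda>v. {c, v}) ` (?V - {c})"
    by blast
  define A where "A = {a. (a, c) \<in> edges D}"
  define B where "B = {b. (c, b) \<in> edges D}"
  \<comment> \<open>Disjointness holds because each edge carries only one orientation;
    \<open>c\<close> lies in neither set because there are no loops.\<close>
  have AB: "A \<subseteq> ?V" "B \<subseteq> ?V" "c \<notin> A" "c \<notin> B" "A \<inter> B = {}"
    using D(2,3) by (auto simp: A_def B_def)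
  interpret weighted_star c A B "weight D"
    by unfold_locales (use AB D c finite_subset in auto)
  have edge: "x = c \<or> y = c" if "(x, y) \<in> edges D" for x y
  proof -
    have "{x, y} \<in> underlying_edges D" using that by (auto simp: underlying_edges_def)
    then show ?thesis unfolding star by (auto simp: doubleton_eq_iff)
  qed
  have "{mvar x * mvar y ^ weight D y | x y. (x, y) \<in> edges D}
      = (\<lambda>g. Poly_Mapping.single g (1::'k)) ` star_gens"
  proof -
    have e: "mvar x * mvar y ^ weight D y = Poly_Mapping.single
        (Poly_Mapping.single x 1 + Poly_Mapping.single y (weight D y)) (1::'k)" for x y
      by (simp only: mvar_power) (simp add: mvar_def mult_single)
    \<comment> \<open>Every edge has \<open>c\<close> as head or tail, so the two families of
      generators cover all edges.\<close>
    have gens: "star_gens = {Poly_Mapping.single x 1 + Poly_Mapping.single y (weight D y) | x y. (x, y) \<in> edges D}"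
      unfolding star_gens_def unfolding A_def B_def using edge by blast
    show ?thesis unfolding e gens by blast
  qed
  moreover have "Poly_Mapping.keys g \<subseteq> ?V" if "g \<in> star_gens" for g
    using that AB c by (auto simp: star_gens_def keys_add_nat split: if_splits)
  ultimately have I: "edge_ideal D = (monomial_ideal ?V star_monomials :: ('v, 'k) mpoly set)"
    unfolding edge_ideal_def star_monomials_def by (simp add: genideal_monomials)
  \<comment> \<open>As \<open>n\<close> is at least 2 there is a leaf, and its edge is oriented
    towards or away from the center.\<close>
  have "A \<union> B \<noteq> {}"
  proof -
    have "card (?V - {c}) \<ge> 2"
      using assms(2,3) D(1) c by (simp add: star_graph_def)
    then have "?V - {c} \<noteq> {}" by force
    then have "underlying_edges D \<noteq> {}" by (simp add: star)
    then obtain x y where "(x, y) \<in> edges D"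
      by (auto simp: underlying_edges_def)
    then show ?thesis using edge by (auto simp: A_def B_def)
  qed
  \<comment> \<open>Without incoming edges the center is a source.\<close>
  moreover have "weight D c = 1" if "A = {}"
    using that c by (intro D(5)) (auto simp: is_source_def A_def)
  ultimately show ?thesis
    unfolding I using AB c D(1) by (intro symbolic_power_star_monomials) auto
qed

end
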